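(* For any $\lambda>0$ and any $\delta\in(0,1)$, with probability at least $1-\delta$, $$\Big\|\frac{\hat\alpha^{\rm MLE}}{\hat\sigma_{\rm MLE}}-\frac{\alpha^*}{\sigma^*}\Big\|_{Q^\top(\Sigma_D+\lambda\mathbf{I})Q}\le\sqrt{\frac{R_D+2\sqrt{-R_D\log\delta}-2\log\delta}{\omega^2K}}+\sqrt{\frac{R_D+2\sqrt{-R_D\log\delta}-2\log\delta}{\omega^2K}+\lambda\big(\bar c\sqrt{N-1}\big)^2},$$ where $\Sigma_D=\frac1KP^\top P\in\mathbb{R}^{(N-1)\times(N-1)}$, $R_D:=\mathrm{rank}(\Sigma_D)$ and $\omega:=\frac{1}{2+2\exp(2\bar c)}$.
   Context: Fix constants $\bar b>0$, $L>0$, $\bar c>0$. $\mathcal{U}_c$ is the set of all functions $u:[0,\bar b]\to\mathbb{R}$ that are monotonically increasing (in the weak sense, i.e. nondecreasing), concave, Lipschitz continuous with modulus at most $L$, and satisfy $u(0)=0$, $u(\bar b)=1$. Data and model: $(W_k,Y_k)$, $k=1,\dots,K$, are given (non-random) pairs of lotteries, each lottery having finite support in $[0,\bar b]$. There are a true utility function $u^*\in\mathcal{U}_c$ and a true scale parameter $\sigma^*\ge1/\bar c$ such that the response is $Z_k=1$ if $\mathbb{E}[u^*(W_k)]+\varepsilon_{1k}\ge\mathbb{E}[u^*(Y_k)]+\varepsilon_{2k}$ and $Z_k=-1$ otherwise, where all $\varepsilon_{1k},\varepsilon_{2k}$ are i.i.d. $\mathrm{Gumbel}(0,\sigma^* )$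 (CDF $e^{-e^{-x/\sigma^*}}$). Thus the $Z_k$ are independent with $\mathbb{P}(Z_k=1)=1/\big(1+\exp(-(\mathbb{E}[u^*(W_k)]-\mathbb{E}[u^*(Y_k)])/\sigma^* )\big)$; probability refers to the randomness of $(Z_1,\dots,Z_K)$. Let $\{y_1<\dots<y_N\}$ be the ordered list of all points of $\{0,\bar b\}\cup\bigcup_k \mathrm{supp}(W_k)\cup\bigcup_k\mathrm{supp}(Y_k)$ ($y_1=0$, $y_N=\bar b$), and $\alpha^*=(u^*(y_1),\dots,u^*(y_N))^\top$. Put $p^k_j=\mathbb{P}[W_k=y_j]-\mathbb{P}[Y_k=y_j]$, $p^k_{2:N}=(p^k_2,\dots,p^k_N)^\top$, let $P\in\mathbb{R}^{K\times(N-1)}$ have $k$-th row $(p^k_{2:N})^\top$, and let $Q=[\mathbf{0}_{(N-1)\times1},\mathbf{I}_{N-1}]\in\mathbb{R}^{(N-1)\times N}$. For a positive semidefinite matrix $A$, $\|x\|_A=\sqrt{x^\top Ax}$. MLE: let $(\bar\alpha^*,\bar\beta^*,\gamma^* )$ be an optimal solution of: maximize $-\sum_{k}\log\big[1+\exp\big(\sum_{j=1}^N -Z_kp^k_j\bar\alpha_j\big)\big]$ over $\bar\alpha\in\mathbb{R}^N$, $\bar\beta\in\mathbb{R}^{N-1}$, $\gamma\in[0,\bar c]$ subject to $\bar\beta_j=(\bar\alpha_{j+1}-\bar\alpha_j)/(y_{j+1}-y_j)$ ($1\le j\le N-1$), $\bar\beta_{j+1}\le\bar\beta_j$ ($1\le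 j\le N-2$), $\bar\beta_1\le L\gamma$, $\bar\beta_{N-1}\ge0$, $\bar\alpha_1=0$, $\bar\alpha_N=\gamma$. Then $\hat\alpha^{\rm MLE}=\bar\alpha^*/\gamma^*$ and $\hat\sigma_{\rm MLE}=1/\gamma^*$, so that $\hat\alpha^{\rm MLE}/\hat\sigma_{\rm MLE}=\bar\alpha^*$; if $\gamma^*=0$ (where $\hat\sigma_{\rm MLE}=+\infty$ and $\bar\alpha^*=0$), the ratio is read as $\bar\alpha^*=0$. *)

theory Defs
  imports "HOL-Probability.Probability" "Jordan_Normal_Form.DL_Rank"
begin

unbundle no vec_syntax
unbundle no inner_syntax
no_notation fps_nth (infixl "$" 75)

text \<open>Indices are 0-based throughout: the pairs of lotteries are numbered by \<open>k < K\<close>, and the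
  point \<open>y\<^sub>j\<close> of the informal notation is \<open>y ! (j - 1)\<close>.\<close>

definition utility_class :: "real \<Rightarrow> real \<Rightarrow> (real \<Rightarrow> real) set" where
  "utility_class b L =
     {u. mono_on {0..b} u \<and> concave_on {0..b} u \<and> L-lipschitz_on {0..b} u \<and> u 0 = 0 \<and> u b = 1}"

definition lottery :: "real \<Rightarrow> real pmf \<Rightarrow> bool" where
  "lottery b W \<longleftrightarrow> finite (set_pmf W) \<and> set_pmf W \<subseteq> {0..b}"

definition gumbel_cdf :: "real \<Rightarrow> real \<Rightarrow> real \<Rightarrow> real" where
  "gumbel_cdf \<mu> \<sigma> x = exp (- exp (- (x - \<mu>) / \<sigma>))"

definition response ::
  "(real \<Rightarrow> real) \<Rightarrow> real pmf \<Rightarrow> real pmf \<Rightarrow> real \<Rightarrow> real \<Rightarrow> real" where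
  "response u W Y e1 e2 =
     (if measure_pmf.expectation W u + e1 \<ge> measure_pmf.expectation Y u + e2 then 1 else -1)"

definition grid :: "real \<Rightarrow> nat \<Rightarrow> (nat \<Rightarrow> real pmf) \<Rightarrow> (nat \<Rightarrow> real pmf) \<Rightarrow> real list" where
  "grid b K W Y =
     sorted_list_of_set ({0, b} \<union> (\<Union>k<K. set_pmf (W k)) \<union> (\<Union>k<K. set_pmf (Y k)))"

definition pdiff ::
  "real list \<Rightarrow> (nat \<Rightarrow> real pmf) \<Rightarrow> (nat \<Rightarrow> real pmf) \<Rightarrow> nat \<Rightarrow> nat \<Rightarrow> real" where
  "pdiff y W Y k j = pmf (W k) (y ! j) - pmf (Y k) (y ! j)"

definition P_mat ::
  "real list \<Rightarrow> nat \<Rightarrow> (nat \<Rightarrow> real pmf) \<Rightarrow> (nat \<Rightarrow> real pmf) \<Rightarrow> real mat" where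
  "P_mat y K W Y = mat K (length y - 1) (\<lambda>(k, j). pdiff y W Y k (j + 1))"

text \<open>The block matrix \<open>[0, I]\<close> with \<open>N - 1\<close> rows and \<open>N\<close> columns.\<close>

definition Q_mat :: "nat \<Rightarrow> real mat" where
  "Q_mat N = mat (N - 1) N (\<lambda>(i, j). if j = i + 1 then 1 else 0)"

definition Sigma_D ::
  "real list \<Rightarrow> nat \<Rightarrow> (nat \<Rightarrow> real pmf) \<Rightarrow> (nat \<Rightarrow> real pmf) \<Rightarrow> real mat" where
  "Sigma_D y K W Y = (1 / real K) \<cdot>\<^sub>m (transpose_mat (P_mat y K W Y) * P_mat y K W Y)"

definition mat_seminorm :: "real mat \<Rightarrow> real vec \<Rightarrow> real" where
  "mat_seminorm A x = sqrt (x \<bullet> (A *\<^sub>v x))"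

definition log_likelihood ::
  "real list \<Rightarrow> nat \<Rightarrow> (nat \<Rightarrow> real pmf) \<Rightarrow> (nat \<Rightarrow> real pmf) \<Rightarrow> (nat \<Rightarrow> real) \<Rightarrow> real vec \<Rightarrow> real" where
  "log_likelihood y K W Y z \<alpha> =
     - (\<Sum>k<K. ln (1 + exp (\<Sum>j<length y. - z k * pdiff y W Y k j * \<alpha> $ j)))"

definition mle_feasible ::
  "real list \<Rightarrow> real \<Rightarrow> real \<Rightarrow> real vec \<Rightarrow> real vec \<Rightarrow> real \<Rightarrow> bool" where
  "mle_feasible y L c \<alpha> \<beta> \<gamma> \<longleftrightarrow> (let N = length y in
     \<alpha> \<in> carrier_vec N \<and> \<beta> \<in> carrier_vec (N - 1) \<and> \<gamma> \<in> {0..c} \<and>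
     (\<forall>j<N - 1. \<beta> $ j = (\<alpha> $ (j + 1) - \<alpha> $ j) / (y ! (j + 1) - y ! j)) \<and>
     (\<forall>j<N - 2. \<beta> $ (j + 1) \<le> \<beta> $ j) \<and>
     \<beta> $ 0 \<le> L * \<gamma> \<and> \<beta> $ (N - 2) \<ge> 0 \<and> \<alpha> $ 0 = 0 \<and> \<alpha> $ (N - 1) = \<gamma>)"

definition is_mle ::
  "real list \<Rightarrow> nat \<Rightarrow> (nat \<Rightarrow> real pmf) \<Rightarrow> (nat \<Rightarrow> real pmf) \<Rightarrow> real \<Rightarrow> real \<Rightarrow> (nat \<Rightarrow> real)
     \<Rightarrow> real vec \<Rightarrow> real vec \<Rightarrow> real \<Rightarrow> bool" where
  "is_mle y K W Y L c z \<alpha> \<beta> \<gamma> \<longleftrightarrow>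
     is_arg_max (\<lambda>(\<alpha>, \<beta>, \<gamma>). log_likelihood y K W Y z \<alpha>)
       (\<lambda>(\<alpha>, \<beta>, \<gamma>). mle_feasible y L c \<alpha> \<beta> \<gamma>) (\<alpha>, \<beta>, \<gamma>)"

definition alpha_MLE :: "real vec \<Rightarrow> real \<Rightarrow> real vec" where
  "alpha_MLE \<alpha> \<gamma> = (1 / \<gamma>) \<cdot>\<^sub>v \<alpha>"

definition sigma_MLE :: "real \<Rightarrow> real" where
  "sigma_MLE \<gamma> = 1 / \<gamma>"

text \<open>For \<open>\<gamma> = 0\<close> the scale estimate is infinite and the ratio of the two estimates is read as the
  feasible \<open>\<alpha>\<close> itself, which is then zero. Division by zero in HOL yields exactly this value of
  the ratio, so no case distinction is needed.\<close>

lemma mle_ratio: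
  assumes feas: "mle_feasible y L c \<alpha> \<beta> \<gamma>"
    and y: "sorted_wrt (<) y" "length y \<ge> 2"
  shows "(1 / sigma_MLE \<gamma>) \<cdot>\<^sub>v alpha_MLE \<alpha> \<gamma> = \<alpha>"
proof (cases "\<gamma> = 0")
  case False
  then show ?thesis
    by (intro eq_vecI) (auto simp: sigma_MLE_def alpha_MLE_def)
next
  case True
  define N where "N = length y"
  have N: "N \<ge> 2" using y by (simp add: N_def)
  have car: "\<alpha> \<in> carrier_vec N"
    and step: "\<And>j. j < N - 1 \<Longrightarrow> \<beta> $ j = (\<alpha> $ (j + 1) - \<alpha> $ j) / (y ! (j + 1) - y ! j)"
    and anti: "\<And>j. j < N - 2 \<Longrightarrow> \<beta> $ (j + 1) \<le> \<beta> $ j"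
    and last: "\<beta> $ (N - 2) \<ge> 0" and a0: "\<alpha> $ 0 = 0" and aN: "\<alpha> $ (N - 1) = 0"
    using feas True by (auto simp: mle_feasible_def Let_def N_def)
  have b: "\<beta> $ j \<ge> 0" if "j \<le> N - 2" for j
    using that
  proof (induction j rule: inc_induct)
    case base
    then show ?case using last by simp
  next
    case (step j)
    then show ?case using anti[of j] by simp
  qed
  have mono: "\<alpha> $ j \<le> \<alpha> $ (j + 1)" if j: "j < N - 1" for j
  proof -
    have "y ! j < y ! (j + 1)"
      using y(1) j by (auto simp: sorted_wrt_iff_nth_less N_def)
    moreover have "\<beta> $ j \<ge> 0" using b[of j] j by simp
    ultimately show ?thesis using step[OF j] by (simp add: zero_le_divide_iff)
  qed
  have low: "\<alpha> $ j \<ge> 0" if "j \<le> N - 1" for j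
    using that
  proof (induction j)
    case 0
    then show ?case using a0 by simp
  next
    case (Suc j)
    then show ?case using mono[of j] by simp
  qed
  have up: "\<alpha> $ j \<le> 0" if "j \<le> N - 1" for j
    using that
  proof (induction j rule: inc_induct)
    case base
    then show ?case using aN by simp
  next
    case (step j)
    then show ?case using mono[of j] by simp
  qed
  have "\<alpha> $ j = 0" if "j < N" for j
    using low[of j] up[of j] that by linarith
  then show ?thesis
    using car True by (intro eq_vecI) (auto simp: sigma_MLE_def alpha_MLE_def)
qed

end

theory Submission
  imports Defs
begin

text \<open>Let \<open>D\<close> be the image under the probability differences of the estimation error. Optimality of
  the estimator against the true parameter, together with a second-order lower bound for the
  logistic loss, gives \<open>\<omega>/2 |D|\<^sup>2 \<le> v \<bullet> D\<close>, where \<open>v\<close> is the centred score, whose entries are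
  independent and supported in intervals of length 1. As \<open>D\<close> lies in the column space of \<open>P\<close>, whose
  dimension is \<open>R\<close>, only the projection of \<open>v\<close> to that space matters. Its squared norm has exponential
  moments controlled by Gaussian decoupling, and Chernoff's bound applies. Hoeffding's variance
  proxy \<open>1/4\<close> leaves so much room that the fixed Chernoff exponent \<open>1/2\<close> suffices and the
  cross term \<open>2 sqrt (- R ln \<delta>)\<close> is not needed. The regularisation \<open>\<lambda>\<close> enters only through the crude
  bound \<open>c\<close> on each coordinate of the error.\<close>

section \<open>Logistic loss and orthonormal families\<close>

text \<open>Taylor's theorem at \<open>s\<close>: the second derivative of
  \<open>ln (1 + exp x)\<close> is \<open>1 / (2 + exp x + exp (- x))\<close>, and both exponentials
  are at most \<open>exp c\<close> at any point between \<open>s\<close> and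
  \<open>t\<close>.\<close>

lemma softplus_quadratic_lower_bound:
  fixes s t c :: real
  assumes s: "\<bar>s\<bar> \<le> c" and t: "\<bar>t\<bar> \<le> c"
  shows "ln (1 + exp s) + (t - s) / (1 + exp (- s)) + 1 / (2 + 2 * exp c) / 2 * (t - s)\<^sup>2
           \<le> ln (1 + exp t)"
proof (cases "s = t")
  case False
  \<comment> \<open>The softplus function and its first two derivatives, indexed by order as
    Taylor's theorem expects.\<close>
  define g :: "nat \<Rightarrow> real \<Rightarrow> real" where
    "g = (\<lambda>m. if m = 0 then (\<lambda>x. ln (1 + exp x)) else if m = 1 then (\<lambda>x. 1 / (1 + exp (- x)))
        else (\<lambda>x. exp (- x) / (1 + exp (- x))\<^sup>2))"
  have pos: "1 + exp x > 0" for x :: real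
    by (simp add: add_pos_pos)
  note nz = pos[THEN less_imp_neq, symmetric]
  have "DERIV (g 0) x :> g (Suc 0) x" for x
    unfolding g_def using pos[of x] pos[of "-x"] nz[of x] nz[of "-x"]
    by (auto intro!: derivative_eq_intros simp: divide_simps exp_minus)
  moreover have "DERIV (g 1) x :> g (Suc 1) x" for x
    unfolding g_def using pos[of "-x"] nz[of "-x"]
    by (auto intro!: derivative_eq_intros simp: divide_simps power2_eq_square)
  ultimately have deriv: "\<forall>m x. m < 2 \<and> - c \<le> x \<and> x \<le> c \<longrightarrow> DERIV (g m) x :> g (Suc m) x"
    by (auto simp: less_2_cases_iff)
  have "\<exists>x. (if t < s then t < x \<and> x < s else s < x \<and> x < t) \<and>
      g 0 t = (\<Sum>m<2. (g m s / fact m) * (t - s)^m) + (g 2 x / fact 2) * (t - s)^2"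
    using s t False by (intro Taylor[OF _ refl deriv]) auto
  then obtain x where between: "if t < s then t < x \<and> x < s else s < x \<and> x < t" and
    eq: "g 0 t = (\<Sum>m<2. (g m s / fact m) * (t - s)^m) + (g 2 x / fact 2) * (t - s)^2"
    by blast
  have x: "\<bar>x\<bar> \<le> c" using between s t by (auto split: if_splits)
  have "1 / (2 + 2 * exp c) \<le> g 2 x"
  proof -
    have "exp x \<le> exp c" "exp (- x) \<le> exp c" using x by auto
    then have "exp x + exp (- x) \<le> 2 * exp c" by linarith
    then have "1 / (2 + 2 * exp c) \<le> 1 / (2 + exp x + exp (- x))"
      by (intro divide_left_mono mult_pos_pos add_pos_pos) auto
    also have "\<dots> = g 2 x"
    proof -
      have "(1 + exp (- x))\<^sup>2 = exp (- x) * (2 + exp x + exp (- x))"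
        by (simp add: power2_eq_square algebra_simps flip: exp_add)
      then show ?thesis by (simp add: g_def)
    qed
    finally show ?thesis .
  qed
  then have "1 / (2 + 2 * exp c) / 2 * (t - s)\<^sup>2 \<le> g 2 x / 2 * (t - s)\<^sup>2"
    by (intro mult_right_mono divide_right_mono) auto
  then show ?thesis
    using eq by (simp add: g_def numeral_2_eq_2)
qed auto

text \<open>Vectors of dimension \<open>K\<close> are functions on \<open>nat\<close> of which only the values at \<open>k < K\<close> count.\<close>

definition orthonormal :: "nat \<Rightarrow> (nat \<Rightarrow> nat \<Rightarrow> real) \<Rightarrow> nat \<Rightarrow> bool" where
  "orthonormal K e r \<longleftrightarrow>
     (\<forall>i<r. \<forall>j<r. (\<Sum>k<K. e i k * e j k) = (if i = j then 1 else 0))"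

text \<open>One Gram-Schmidt step. If \<open>x\<close> already lies in the span, the residual
  vanishes and no vector is added, hence only \<open>r' \<le> Suc r\<close>. Old members are kept so
  that earlier expansions survive.\<close>

lemma orthonormal_extend:
  fixes e :: "nat \<Rightarrow> nat \<Rightarrow> real" and x :: "nat \<Rightarrow> real"
  assumes e: "orthonormal K e r"
  obtains r' e' where "r' \<le> Suc r" "orthonormal K e' r'"
    "r \<le> r'" "\<And>i. i < r \<Longrightarrow> e' i = e i"
    "\<exists>a. \<forall>k<K. x k = (\<Sum>i<r'. a i * e' i k)"
proof -
  \<comment> \<open>What remains of \<open>x\<close> after removing its orthogonal projection to the
    span of the family.\<close>
  define w where "w k = x k - (\<Sum>i<r. (\<Sum>l<K. e i l * x l) * e i k)" for k
  have ow: "(\<Sum>k<K. e j k * w k) = 0" if j: "j < r" for j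
  proof -
    have "(\<Sum>k<K. e j k * w k) = (\<Sum>k<K. e j k * x k)
        - (\<Sum>k<K. \<Sum>i<r. (\<Sum>l<K. e i l * x l) * (e j k * e i k))"
      by (simp add: w_def algebra_simps sum_subtractf sum_distrib_left)
    also have "(\<Sum>k<K. \<Sum>i<r. (\<Sum>l<K. e i l * x l) * (e j k * e i k))
        = (\<Sum>i<r. (\<Sum>l<K. e i l * x l) * (\<Sum>k<K. e j k * e i k))"
      by (subst sum.swap) (simp add: sum_distrib_left)
    also have "\<dots> = (\<Sum>i<r. (\<Sum>l<K. e i l * x l) * (if j = i then 1 else 0))"
      using e j by (intro sum.cong) (auto simp: orthonormal_def)
    also have "\<dots> = (\<Sum>l<K. e j l * x l)"
      using j by (simp add: if_distrib cong: if_cong)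
    finally show ?thesis by simp
  qed
  define n where "n = (\<Sum>k<K. w k * w k)"
  have n0: "n \<ge> 0" by (auto simp: n_def intro: sum_nonneg)
  show ?thesis
  proof (cases "n = 0")
    case True
    then have "\<forall>k<K. w k = 0"
      by (simp add: n_def sum_nonneg_eq_0_iff)
    then have "\<forall>k<K. x k = (\<Sum>i<r. (\<Sum>l<K. e i l * x l) * e i k)"
      unfolding w_def eq_iff_diff_eq_0[symmetric] .
    then have "\<exists>a. \<forall>k<K. x k = (\<Sum>i<r. a i * e i k)"
      by (rule exI[where x = "\<lambda>i. \<Sum>l<K. e i l * x l"])
    then show ?thesis
      by (rule that[OF le_SucI[OF order_refl] e order_refl refl])
  next
    case False
    define e' where "e' = e(r := (\<lambda>k. w k / sqrt n))"
    have unit: "(\<Sum>k<K. w k / sqrt n * (w k / sqrt n)) = 1"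
      using False n0 by (simp add: n_def[symmetric] sum_divide_distrib[symmetric])
    have orth: "(\<Sum>k<K. e j k * (w k / sqrt n)) = 0" if "j < r" for j
      using ow[OF that] by (simp add: sum_divide_distrib[symmetric])
    have orth': "(\<Sum>k<K. (w k / sqrt n) * e j k) = 0" if "j < r" for j
      using orth[OF that] by (simp add: mult.commute)
    have on: "orthonormal K e' (Suc r)"
      unfolding orthonormal_def
    proof (intro allI impI)
      fix i j assume ij: "i < Suc r" "j < Suc r"
      then consider "i < r" "j < r" | "i = r" "j < r" | "i < r" "j = r" | "i = r" "j = r"
        by linarith
      then show "(\<Sum>k<K. e' i k * e' j k) = (if i = j then 1 else 0)"
      proof cases
        case 1 then show ?thesis using e by (auto simp: e'_def orthonormal_def)
      next
        case 2 then show ?thesis using orth'[of j] by (simp add: e'_def)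
      next
        case 3 then show ?thesis using orth[of i] by (simp add: e'_def)
      next
        case 4 then show ?thesis using unit by (simp add: e'_def)
      qed
    qed
    \<comment> \<open>The coefficient of the new unit vector is \<open>sqrt n\<close>, the norm of
      the residual.\<close>
    have "\<forall>k<K. x k = (\<Sum>i<Suc r. (if i = r then sqrt n else \<Sum>l<K. e i l * x l) * e' i k)"
    proof (intro allI impI)
      fix k
      have "(\<Sum>i<Suc r. (if i = r then sqrt n else \<Sum>l<K. e i l * x l) * e' i k) =
          (\<Sum>i<r. (\<Sum>l<K. e i l * x l) * e i k) + w k"
        using False n0 by (simp add: e'_def)
      then show "x k = (\<Sum>i<Suc r. (if i = r then sqrt n else \<Sum>l<K. e i l * x l) * e' i k)"
        by (simp add: w_def)
    qed
    then have ex: "\<exists>a. \<forall>k<K. x k = (\<Sum>i<Suc r. a i * e' i k)"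
      by (rule exI[where x = "\<lambda>i. if i = r then sqrt n else \<Sum>l<K. e i l * x l"])
    show ?thesis
      by (rule that[OF order_refl on _ _ ex]) (simp_all add: e'_def)
  qed
qed

text \<open>Iterates the extension step. The vectors \<open>x j\<close> may be dependent, so
  \<open>r\<close> can stay below \<open>m\<close>.\<close>

lemma gram_schmidt_functions:
  fixes x :: "nat \<Rightarrow> nat \<Rightarrow> real"
  obtains r e where "r \<le> m" "orthonormal K e r"
    "\<And>j. j < m \<Longrightarrow> \<exists>a. \<forall>k<K. x j k = (\<Sum>i<r. a i * e i k)"
proof -
  have "\<exists>r e. r \<le> m \<and> orthonormal K e r \<and>
          (\<forall>j<m. \<exists>a. \<forall>k<K. x j k = (\<Sum>i<r. a i * e i k))"
  proof (induction m)
    case 0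
    show ?case by (intro exI[of _ 0]) (auto simp: orthonormal_def)
  next
    case (Suc m)
    then obtain r e where re: "r \<le> m" "orthonormal K e r"
      and span: "\<And>j. j < m \<Longrightarrow> \<exists>a. \<forall>k<K. x j k = (\<Sum>i<r. a i * e i k)" by blast
    from re(2) obtain r' e' where r'e': "r' \<le> Suc r" "orthonormal K e' r'"
      "r \<le> r'" "\<And>i. i < r \<Longrightarrow> e' i = e i"
      "\<exists>a. \<forall>k<K. x m k = (\<Sum>i<r'. a i * e' i k)"
      by (rule orthonormal_extend[where x = "x m"]) blast
    have "\<exists>a. \<forall>k<K. x j k = (\<Sum>i<r'. a i * e' i k)" if j: "j < m" for j
    proof -
      from span[OF j] obtain a where a: "\<And>k. k < K \<Longrightarrow> x j k = (\<Sum>i<r. a i * e i k)" by blast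
      \<comment> \<open>An expansion in the old family stays valid in the new one after padding the
        coefficients with zeros.\<close>
      have "(\<Sum>i<r'. (if i < r then a i else 0) * e' i k) = (\<Sum>i<r. a i * e i k)" for k
      proof -
        have "(\<Sum>i<r'. (if i < r then a i else 0) * e' i k) =
              (\<Sum>i<r. (if i < r then a i else 0) * e' i k)"
          using r'e'(3) by (intro sum.mono_neutral_right) auto
        then show ?thesis using r'e'(4) by simp
      qed
      with a show ?thesis by (intro exI[of _ "\<lambda>i. if i < r then a i else 0"]) simp
    qed
    with r'e' re(1) show ?case by (intro exI[of _ r'] exI[of _ e']) (auto simp: less_Suc_eq)
  qed
  then show ?thesis using that by blast
qed

text \<open>Columns of \<open>P\<close> whose images under \<open>P\<^sup>T\<close> form a basis of the column space of the Gram matrix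
  span all columns of \<open>P\<close>, because \<open>P\<^sup>T w = 0\<close> with \<open>w\<close> in the column space of \<open>P\<close> forces
  \<open>w = 0\<close>.\<close>

lemma rank_gram_spanning_columns:
  fixes P :: "real mat"
  assumes P: "P \<in> carrier_mat K n" and s: "s \<noteq> 0"
  defines "G \<equiv> s \<cdot>\<^sub>m (transpose_mat P * P)"
  obtains f where "\<And>i. i < vec_space.rank n G \<Longrightarrow> f i < n"
    "\<And>j. j < n \<Longrightarrow> \<exists>a. \<forall>k<K. P $$ (k, j) = (\<Sum>i<vec_space.rank n G. a i * P $$ (k, f i))"
proof -
  interpret V: vec_space "TYPE(real)" n .
  have G: "G \<in> carrier_mat n n" using P by (auto simp: G_def)
  have G_ij: "G $$ (i, j) = s * (\<Sum>k<K. P $$ (k, i) * P $$ (k, j))" if "i < n" "j < n" for i j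
    using P that by (simp add: G_def scalar_prod_def atLeast0LessThan)
  have colsG: "set (cols G) \<subseteq> carrier_vec n" using G cols_dim by blast
  \<comment> \<open>A maximal independent set of columns of \<open>G\<close> has cardinality equal
    to the rank, and by maximality it spans all columns.\<close>
  have "\<exists>U. finite U \<and> maximal U (\<lambda>T. T \<subseteq> set (cols G) \<and> V.lin_indpt T) \<and> {} \<subseteq> U"
    by (rule maximal_exists_superset[of "set (cols G)"]) (auto simp: V.finite_lin_indpt2)
  then obtain U where finU: "finite U"
    and maxU: "maximal U (\<lambda>T. T \<subseteq> set (cols G) \<and> V.lin_indpt T)" by blast
  have rank: "vec_space.rank n G = card U" by (rule V.rank_card_indpt[OF G maxU])
  have U: "U \<subseteq> set (cols G)" "V.lin_indpt U" using maxU by (auto simp: maximal_def)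
  have Uc: "U \<subseteq> carrier_vec n" using U colsG by blast
  have in_span: "x \<in> V.span U" if x: "x \<in> set (cols G)" for x
  proof (rule ccontr)
    assume nx: "x \<notin> V.span U"
    then have "V.lin_indpt (U \<union> {x})"
      using V.lin_dep_iff_in_span[of U x] V.span_mem[OF Uc] x colsG U(2) Uc by blast
    with maxU U(1) x have "U \<union> {x} = U" unfolding maximal_def by blast
    with nx V.span_mem[OF Uc] show False by blast
  qed
  \<comment> \<open>\<open>U\<close> consists of vectors, whereas column numbers are required:
    \<open>g\<close> picks one for each vector and \<open>h\<close> enumerates
    \<open>U\<close>.\<close>
  have "\<forall>x\<in>U. \<exists>i<n. x = col G i"
    using U(1) G by (fastforce simp: cols_def)
  then obtain g where g: "\<And>x. x \<in> U \<Longrightarrow> g x < n \<and> x = col G (g x)" by metis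
  from ex_bij_betw_nat_finite[OF finU] obtain h where h: "bij_betw h {..<card U} U"
    by (auto simp: atLeast0LessThan)
  show ?thesis
  proof (rule that[of "g \<circ> h"])
    fix i assume "i < vec_space.rank n G"
    then have "h i \<in> U" using h rank by (auto simp: bij_betw_def)
    then show "(g \<circ> h) i < n" using g by simp
  next
    fix j assume j: "j < n"
    have colj: "col G j \<in> V.span U" using in_span j G by (auto simp: cols_def)
    obtain a where a: "col G j = V.lincomb a U"
      using V.finite_in_span[OF finU Uc colj] by metis
    \<comment> \<open>The coefficients of the relation among columns of \<open>G\<close> are reused
      for columns of \<open>P\<close>; \<open>w\<close> is the defect, to be shown zero.\<close>
    define w where "w k = P $$ (k, j) - (\<Sum>x\<in>U. a x * P $$ (k, g x))" for k
    have orth: "(\<Sum>k<K. P $$ (k, i) * w k) = 0" if i: "i < n" for i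
    proof -
      have "G $$ (i, j) = (\<Sum>x\<in>U. a x * x $ i)"
        using arg_cong[OF a, of "\<lambda>v. v $ i"] V.lincomb_index[OF i Uc] i j G by simp
      also have "\<dots> = (\<Sum>x\<in>U. a x * G $$ (i, g x))"
      proof (rule sum.cong[OF refl])
        fix x assume "x \<in> U"
        then have "g x < n" "x = col G (g x)" using g by auto
        then show "a x * x $ i = a x * G $$ (i, g x)"
          using G i by (metis carrier_matD index_col)
      qed
      finally have "s * (\<Sum>k<K. P $$ (k, i) * P $$ (k, j)) =
          (\<Sum>x\<in>U. a x * (s * (\<Sum>k<K. P $$ (k, i) * P $$ (k, g x))))"
        using G_ij i j g by simp
      also have "\<dots> = s * (\<Sum>k<K. P $$ (k, i) * (\<Sum>x\<in>U. a x * P $$ (k, g x)))"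
        by (simp add: sum_distrib_left, subst sum.swap, simp add: algebra_simps)
      finally show ?thesis
        using s by (simp add: w_def algebra_simps sum_subtractf)
    qed
    \<comment> \<open>The defect is a combination of columns of \<open>P\<close> and orthogonal to
      all of them, hence orthogonal to itself.\<close>
    have "(\<Sum>k<K. w k * w k) =
        (\<Sum>k<K. P $$ (k, j) * w k) - (\<Sum>k<K. \<Sum>x\<in>U. a x * (P $$ (k, g x) * w k))"
      unfolding sum_subtractf[symmetric] 
      by (intro sum.cong[OF refl]) (simp add: w_def[symmetric] sum_distrib_right[symmetric] 
         mult.assoc[symmetric] left_diff_distrib[symmetric])
    also have "(\<Sum>k<K. \<Sum>x\<in>U. a x * (P $$ (k, g x) * w k)) =
        (\<Sum>x\<in>U. a x * (\<Sum>k<K. P $$ (k, g x) * w k))"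
      by (subst sum.swap) (simp add: sum_distrib_left)
    also have "\<dots> = 0" using orth g by simp
    finally have "(\<Sum>k<K. w k * w k) = 0" using orth[OF j] by simp
    then have "\<forall>k<K. w k = 0" by (simp add: sum_nonneg_eq_0_iff)
    moreover have "(\<Sum>x\<in>U. a x * P $$ (k, g x)) = (\<Sum>i<card U. a (h i) * P $$ (k, (g \<circ> h) i))" for k
      using sum.reindex_bij_betw[OF h, of "\<lambda>x. a x * P $$ (k, g x)"] by simp
    ultimately show "\<exists>a. \<forall>k<K. P $$ (k, j) =
        (\<Sum>i<vec_space.rank n G. a i * P $$ (k, (g \<circ> h) i))"
      unfolding rank by (intro exI[of _ "\<lambda>i. a (h i)"]) (simp add: w_def)
  qed
qed

section \<open>Sub-Gaussian projections\<close>

text \<open>Completing the square turns the integrand into a multiple of the normal density with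
  mean \<open>a / d\<close> and variance \<open>1 / d\<close>, where \<open>d = 1 - 2 * q\<close> is
  positive.\<close>

lemma nn_integral_normal_exp_quadratic:
  fixes a q :: real
  assumes q: "q < 1 / 2"
  shows "(\<integral>\<^sup>+g. ennreal (std_normal_density g * exp (a * g + q * g\<^sup>2)) \<partial>lborel)
           = ennreal (1 / sqrt (1 - 2 * q) * exp (a\<^sup>2 / (2 * (1 - 2 * q))))"
proof -
  define d where "d = 1 - 2 * q"
  have d: "d > 0" using q by (simp add: d_def)
  have eq: "std_normal_density g * exp (a * g + q * g\<^sup>2)
      = 1 / sqrt d * exp (a\<^sup>2 / (2 * d)) * normal_density (a / d) (1 / sqrt d) g" for g
  proof -
    have e: "- g\<^sup>2 / 2 + (a * g + q * g\<^sup>2) = a\<^sup>2 / (2 * d) - (g - a / d)\<^sup>2 * d / 2"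
    proof -
      have "a\<^sup>2 / (2 * d) - (g - a / d)\<^sup>2 * d / 2 = a * g - d * g\<^sup>2 / 2"
        using d by (simp add: field_simps power2_eq_square)
      then show ?thesis by (simp add: d_def field_simps)
    qed
    have "std_normal_density g * exp (a * g + q * g\<^sup>2)
        = 1 / sqrt (2 * pi) * exp (- g\<^sup>2 / 2 + (a * g + q * g\<^sup>2))"
      by (simp add: std_normal_density_def flip: exp_add)
    also have "\<dots> = 1 / sqrt (2 * pi) * (exp (a\<^sup>2 / (2 * d)) * exp (- ((g - a / d)\<^sup>2 * d / 2)))"
      unfolding e by (simp flip: exp_add)
    also have "\<dots> = 1 / sqrt d * exp (a\<^sup>2 / (2 * d)) * normal_density (a / d) (1 / sqrt d) g"
      using d by (simp add: normal_density_def real_sqrt_mult real_sqrt_divide power_divide)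
    finally show ?thesis .
  qed
  have "(\<integral>\<^sup>+g. ennreal (normal_density (a / d) (1 / sqrt d) g) \<partial>lborel) = 1"
    using d by (subst nn_integral_eq_integral) (auto intro: integrable_normal_density)
  moreover have "1 / sqrt d * exp (a\<^sup>2 / (2 * d)) \<ge> 0" using d by simp
  ultimately show ?thesis
    unfolding eq d_def[symmetric] by (simp only: ennreal_mult') (simp add: nn_integral_cmult)
qed

text \<open>Decoupling: \<open>exp (x\<^sup>2 / 2)\<close> is the Gaussian average of \<open>exp (g x)\<close>, so each square in the
  exponent becomes a random shift of the linear term \<open>h\<close>.\<close>

lemma subgaussian_projection_mgf:
  fixes V :: "nat \<Rightarrow> 'a \<Rightarrow> real"
  assumes sf: "sigma_finite_measure M"
    and V[measurable]: "\<And>k. k < K \<Longrightarrow> V k \<in> borel_measurable M"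
    and v: "0 \<le> v" "v < 1"
    and subg: "\<And>h. (\<integral>\<^sup>+\<xi>. ennreal (exp (\<Sum>k<K. h k * V k \<xi>)) \<partial>M)
                 \<le> ennreal (exp (v / 2 * (\<Sum>k<K. (h k)\<^sup>2)))"
    and e: "orthonormal K e r"
  shows "(\<integral>\<^sup>+\<xi>. ennreal (exp (1 / 2 * (\<Sum>i<r. (\<Sum>k<K. e i k * V k \<xi>)\<^sup>2)
              + (\<Sum>k<K. h k * V k \<xi>))) \<partial>M)
     \<le> ennreal ((1 / sqrt (1 - v)) ^ r * exp (v / 2 * (\<Sum>k<K. (h k)\<^sup>2)
          + v\<^sup>2 / (2 * (1 - v)) * (\<Sum>i<r. (\<Sum>k<K. e i k * h k)\<^sup>2)))"
  using e
\<comment> \<open>The linear term must be general: removing the square along \<open>e r\<close>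
  shifts \<open>h\<close> to \<open>h + g * e r\<close>.\<close>
proof (induction r arbitrary: h)
  case 0
  then show ?case using subg[of h] by simp
next
  case (Suc r)
  interpret sigma_finite_measure M by (rule sf)
  interpret L: pair_sigma_finite M lborel ..
  have e: "orthonormal K e r" using Suc.prems by (auto simp: orthonormal_def)
  have orth: "(\<Sum>k<K. e i k * e r k) = 0" if "i < r" for i
    using Suc.prems that by (auto simp: orthonormal_def)
  have unit: "(\<Sum>k<K. (e r k)\<^sup>2) = 1"
    using Suc.prems by (auto simp: orthonormal_def power2_eq_square)
  define S where "S \<xi> = 1 / 2 * (\<Sum>i<r. (\<Sum>k<K. e i k * V k \<xi>)\<^sup>2)" for \<xi>
  define X where "X \<xi> = (\<Sum>k<K. e r k * V k \<xi>)" for \<xi>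
  define H where "H \<xi> = (\<Sum>k<K. h k * V k \<xi>)" for \<xi>
  define B where "B = (\<Sum>i<r. (\<Sum>k<K. e i k * h k)\<^sup>2)"
  define C where "C = (1 / sqrt (1 - v)) ^ r"
  define hr where "hr = (\<Sum>k<K. e r k * h k)"
  have C: "C \<ge> 0" using v by (simp add: C_def)
  have [measurable]: "S \<in> borel_measurable M" "X \<in> borel_measurable M" "H \<in> borel_measurable M"
    unfolding S_def X_def H_def by measurable
  have gauss: "ennreal (exp (x\<^sup>2 / 2)) = (\<integral>\<^sup>+g. ennreal (std_normal_density g * exp (x * g)) \<partial>lborel)"
    for x using nn_integral_normal_exp_quadratic[of 0 x] by simp
  have "(\<integral>\<^sup>+\<xi>. ennreal (exp (1 / 2 * (\<Sum>i<Suc r. (\<Sum>k<K. e i k * V k \<xi>)\<^sup>2)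
              + (\<Sum>k<K. h k * V k \<xi>))) \<partial>M)
      = (\<integral>\<^sup>+\<xi>. ennreal (exp (S \<xi> + H \<xi>)) * ennreal (exp ((X \<xi>)\<^sup>2 / 2)) \<partial>M)"
    by (intro nn_integral_cong)
       (simp add: S_def X_def H_def algebra_simps add_divide_distrib flip: ennreal_mult exp_add)
  also have "\<dots> = (\<integral>\<^sup>+\<xi>. (\<integral>\<^sup>+g. ennreal (exp (S \<xi> + H \<xi>))
        * ennreal (std_normal_density g * exp (X \<xi> * g)) \<partial>lborel) \<partial>M)"
    unfolding gauss by (simp add: nn_integral_cmult)
  also have "\<dots> = (\<integral>\<^sup>+g. (\<integral>\<^sup>+\<xi>. ennreal (exp (S \<xi> + H \<xi>))
        * ennreal (std_normal_density g * exp (X \<xi> * g)) \<partial>M) \<partial>lborel)"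
    by (rule L.Fubini'[symmetric]) measurable
  also have "\<dots> = (\<integral>\<^sup>+g. ennreal (std_normal_density g)
        * (\<integral>\<^sup>+\<xi>. ennreal (exp (S \<xi> + (\<Sum>k<K. (h k + g * e r k) * V k \<xi>))) \<partial>M) \<partial>lborel)"
  proof (rule nn_integral_cong)
    fix g :: real
    have "ennreal (exp (S \<xi> + H \<xi>)) * ennreal (std_normal_density g * exp (X \<xi> * g))
        = ennreal (std_normal_density g) *
          ennreal (exp (S \<xi> + (\<Sum>k<K. (h k + g * e r k) * V k \<xi>)))" for \<xi>
    proof -
      have "(\<Sum>k<K. (h k + g * e r k) * V k \<xi>) = H \<xi> + X \<xi> * g"
        by (simp add: H_def X_def sum.distrib sum_distrib_left algebra_simps)
      then show ?thesis by (simp add: exp_add mult_ac flip: ennreal_mult)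
    qed
    then show "(\<integral>\<^sup>+\<xi>. ennreal (exp (S \<xi> + H \<xi>))
        * ennreal (std_normal_density g * exp (X \<xi> * g)) \<partial>M) = ennreal (std_normal_density g)
        * (\<integral>\<^sup>+\<xi>. ennreal (exp (S \<xi> + (\<Sum>k<K. (h k + g * e r k) * V k \<xi>))) \<partial>M)"
      by (simp add: nn_integral_cmult)
  qed
  also have "\<dots> \<le> (\<integral>\<^sup>+g. ennreal (std_normal_density g)
        * ennreal (C * exp (v / 2 * (\<Sum>k<K. (h k + g * e r k)\<^sup>2) + v\<^sup>2 / (2 * (1 - v)) * B)) \<partial>lborel)"
  \<comment> \<open>Since \<open>e r\<close> is orthogonal to the earlier members, the shift leaves
    their inner products with \<open>h\<close>, and thus \<open>B\<close>, unchanged.\<close>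
  proof (intro nn_integral_mono mult_left_mono)
    fix g :: real
    have "(\<Sum>k<K. e i k * (h k + g * e r k)) = (\<Sum>k<K. e i k * h k)" if "i < r" for i
    proof -
      have "(\<Sum>k<K. e i k * (h k + g * e r k)) = (\<Sum>k<K. e i k * h k) + g * (\<Sum>k<K. e i k * e r k)"
        by (simp add: sum.distrib sum_distrib_left algebra_simps)
      then show ?thesis using orth[OF that] by simp
    qed
    then have "B = (\<Sum>i<r. (\<Sum>k<K. e i k * (h k + g * e r k))\<^sup>2)" by (simp add: B_def)
    then show "(\<integral>\<^sup>+\<xi>. ennreal (exp (S \<xi> + (\<Sum>k<K. (h k + g * e r k) * V k \<xi>))) \<partial>M)
        \<le> ennreal (C * exp (v / 2 * (\<Sum>k<K. (h k + g * e r k)\<^sup>2) + v\<^sup>2 / (2 * (1 - v)) * B))"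
      using Suc.IH[OF e, of "\<lambda>k. h k + g * e r k"] unfolding S_def C_def by simp
  qed simp
  \<comment> \<open>As \<open>e r\<close> has norm 1, the exponent has quadratic part
    \<open>v / 2 * g\<^sup>2\<close>. The integral over \<open>g\<close> is finite because
    \<open>v < 1\<close>, and it produces the new factor \<open>1 / sqrt (1 - v)\<close> and the new
    summand \<open>(v * hr)\<^sup>2 / (2 * (1 - v))\<close>.\<close>
  also have "\<dots> = (\<integral>\<^sup>+g. ennreal (C * exp (v / 2 * (\<Sum>k<K. (h k)\<^sup>2) + v\<^sup>2 / (2 * (1 - v)) * B))
        * ennreal (std_normal_density g * exp (v * hr * g + v / 2 * g\<^sup>2)) \<partial>lborel)"
  proof (rule nn_integral_cong)
    fix g :: real
    have "(\<Sum>k<K. (h k + g * e r k)\<^sup>2) = (\<Sum>k<K. (h k)\<^sup>2) + 2 * g * hr + g\<^sup>2 * (\<Sum>k<K. (e r k)\<^sup>2)"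
      by (simp add: hr_def power2_sum power_mult_distrib sum.distrib sum_distrib_left algebra_simps)
    then have eq: "v / 2 * (\<Sum>k<K. (h k + g * e r k)\<^sup>2)
        = v / 2 * (\<Sum>k<K. (h k)\<^sup>2) + (v * hr * g + v / 2 * g\<^sup>2)"
      by (simp add: unit algebra_simps)
    show "ennreal (std_normal_density g)
        * ennreal (C * exp (v / 2 * (\<Sum>k<K. (h k + g * e r k)\<^sup>2) + v\<^sup>2 / (2 * (1 - v)) * B))
      = ennreal (C * exp (v / 2 * (\<Sum>k<K. (h k)\<^sup>2) + v\<^sup>2 / (2 * (1 - v)) * B))
        * ennreal (std_normal_density g * exp (v * hr * g + v / 2 * g\<^sup>2))"
      unfolding eq using C by (simp add: exp_add mult_ac flip: ennreal_mult)
  qed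
  also have "\<dots> = ennreal (C * exp (v / 2 * (\<Sum>k<K. (h k)\<^sup>2) + v\<^sup>2 / (2 * (1 - v)) * B))
      * ennreal (1 / sqrt (1 - v) * exp ((v * hr)\<^sup>2 / (2 * (1 - v))))"
    using nn_integral_normal_exp_quadratic[of "v / 2" "v * hr"] v by (simp add: nn_integral_cmult)
  also have "\<dots> = ennreal ((1 / sqrt (1 - v)) ^ Suc r * exp (v / 2 * (\<Sum>k<K. (h k)\<^sup>2)
          + v\<^sup>2 / (2 * (1 - v)) * (\<Sum>i<Suc r. (\<Sum>k<K. e i k * h k)\<^sup>2)))"
  proof -
    have "v\<^sup>2 / (2 * (1 - v)) * (\<Sum>i<Suc r. (\<Sum>k<K. e i k * h k)\<^sup>2)
        = v\<^sup>2 / (2 * (1 - v)) * B + (v * hr)\<^sup>2 / (2 * (1 - v))"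
      by (simp add: B_def hr_def power_mult_distrib distrib_left)
    then show ?thesis
      using C v by (simp add: C_def exp_add mult_ac flip: ennreal_mult)
  qed
  finally show ?case .
qed

section \<open>Exponential moments of bounded variables and the tail of the projected score\<close>

text \<open>The coefficients \<open>h k\<close> used later have arbitrary sign; negative
  \<open>l\<close> reduces to positive \<open>l\<close> by passing to \<open>- X\<close> on
  \<open>{- b..- a}\<close>.\<close>

lemma (in prob_space) Hoeffding_lemma_centred:
  assumes X[measurable]: "random_variable borel X"
    and bd: "\<And>\<xi>. \<xi> \<in> space M \<Longrightarrow> X \<xi> \<in> {a..b}" and E: "expectation X = 0"
  shows "(\<integral>\<^sup>+\<xi>. ennreal (exp (l * X \<xi>)) \<partial>M) \<le> ennreal (exp (l\<^sup>2 * (b - a)\<^sup>2 / 8))"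
proof -
  consider "l > 0" | "l = 0" | "l < 0" by linarith
  then show ?thesis
  proof cases
    case 1
    interpret interval_bounded_random_variable M X a b
      by unfold_locales (use bd in auto)
    show ?thesis by (rule Hoeffdings_lemma_nn_integral_0[OF 1 E])
  next
    case 2
    then show ?thesis using emeasure_space_1 by simp
  next
    case 3
    interpret interval_bounded_random_variable M "\<lambda>\<xi>. - X \<xi>" "- b" "- a"
      by unfold_locales (use bd in auto)
    show ?thesis using Hoeffdings_lemma_nn_integral_0[of "- l"] 3 E by simp
  qed
qed

text \<open>Independence factorises the integral, and Hoeffding's lemma with interval length 1 gives
  \<open>(h k)\<^sup>2 / 8\<close> per factor. The form \<open>1 / 4 / 2\<close> displays the
  variance proxy \<open>v = 1 / 4\<close> of the projection bound.\<close>

lemma (in prob_space) indep_bounded_subgaussian: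
  assumes ind: "indep_vars (\<lambda>_. borel) V {..<K::nat}"
    and bd: "\<And>k \<xi>. k < K \<Longrightarrow> \<xi> \<in> space M \<Longrightarrow> V k \<xi> \<in> {a k..a k + 1}"
    and E: "\<And>k. k < K \<Longrightarrow> expectation (V k) = 0"
  shows "(\<integral>\<^sup>+\<xi>. ennreal (exp (\<Sum>k<K. h k * V k \<xi>)) \<partial>M)
           \<le> ennreal (exp (1 / 4 / 2 * (\<Sum>k<K. (h k)\<^sup>2)))"
proof -
  have V: "random_variable borel (V k)" if "k < K" for k
    using ind that by (auto simp: indep_vars_def)
  have "(\<integral>\<^sup>+\<xi>. ennreal (exp (\<Sum>k<K. h k * V k \<xi>)) \<partial>M)
      = (\<integral>\<^sup>+\<xi>. (\<Prod>k<K. ennreal (exp (h k * V k \<xi>))) \<partial>M)"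
    by (simp add: exp_sum prod_ennreal)
  also have "\<dots> = (\<Prod>k<K. \<integral>\<^sup>+\<xi>. ennreal (exp (h k * V k \<xi>)) \<partial>M)"
    by (intro indep_vars_nn_integral indep_vars_compose2[OF ind]) auto
  also have "\<dots> \<le> (\<Prod>k<K. ennreal (exp ((h k)\<^sup>2 / 8)))"
    using Hoeffding_lemma_centred[OF V bd E] by (intro prod_mono_ennreal) fastforce
  also have "\<dots> = ennreal (exp (1 / 4 / 2 * (\<Sum>k<K. (h k)\<^sup>2)))"
    by (simp add: prod_ennreal sum_divide_distrib flip: exp_sum)
  finally show ?thesis .
qed

text \<open>Chernoff's bound with exponent \<open>1 / 2\<close>: the moment is at most
  \<open>exp (r / 2)\<close>, which cancels against \<open>exp (- (r + 2 * t) / 2)\<close> and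
  leaves \<open>exp (- t)\<close>.\<close>

lemma (in prob_space) projection_tail_bound:
  assumes ind: "indep_vars (\<lambda>_. borel) V {..<K::nat}"
    and bd: "\<And>k \<xi>. k < K \<Longrightarrow> \<xi> \<in> space M \<Longrightarrow> V k \<xi> \<in> {a k..a k + 1}"
    and E: "\<And>k. k < K \<Longrightarrow> expectation (V k) = 0"
    and e: "orthonormal K e r"
  shows "prob {\<xi> \<in> space M. r + 2 * t < (\<Sum>i<r. (\<Sum>k<K. e i k * V k \<xi>)\<^sup>2)} \<le> exp (- t)"
proof -
  have V[measurable]: "random_variable borel (V k)" if "k < K" for k
    using ind that by (auto simp: indep_vars_def)
  define G where "G \<xi> = (\<Sum>i<r. (\<Sum>k<K. e i k * V k \<xi>)\<^sup>2)" for \<xi>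
  have [measurable]: "G \<in> borel_measurable M" unfolding G_def by measurable
  \<comment> \<open>The factor per dimension at \<open>v = 1 / 4\<close>, compared with
    \<open>exp (1 / 2)\<close> through \<open>3 / 2\<close>.\<close>
  have "(1 / sqrt (1 - 1 / 4)) ^ r \<le> (exp (1 / 2)) ^ r"
  proof (rule power_mono)
    have "1 / sqrt (1 - 1 / 4) = sqrt (4 / 3)" by (simp add: real_sqrt_divide)
    also have "\<dots> \<le> 3 / 2" by (rule real_le_lsqrt) (auto simp: power2_eq_square)
    also have "\<dots> \<le> exp (1 / 2)" using exp_ge_add_one_self[of "1 / 2"] by simp
    finally show "1 / sqrt (1 - 1 / 4) \<le> exp (1 / 2)" .
  qed auto
  also have "\<dots> = exp (real r / 2)" by (simp flip: exp_of_nat_mult)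
  finally have const: "(1 / sqrt (1 - 1 / 4)) ^ r \<le> exp (real r / 2)" .
  have "emeasure M {\<xi> \<in> space M. r + 2 * t < G \<xi>} \<le> emeasure M {\<xi> \<in> space M. G \<xi> \<ge> r + 2 * t}"
    by (intro emeasure_mono) auto
  also have "\<dots> \<le> ennreal (exp (- (1 / 2) * (r + 2 * t)))
      * (\<integral>\<^sup>+\<xi>. ennreal (exp (1 / 2 * G \<xi>)) * indicator (space M) \<xi> \<partial>M)"
    by (rule Chernoff_ineq_nn_integral_ge) auto
  also have "\<dots> = ennreal (exp (- (1 / 2) * (r + 2 * t)))
      * (\<integral>\<^sup>+\<xi>. ennreal (exp (1 / 2 * G \<xi>)) \<partial>M)"
    by (intro arg_cong2[where f = "(*)"] nn_integral_cong) auto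
  also have "\<dots> \<le> ennreal (exp (- (1 / 2) * (r + 2 * t))) * ennreal ((1 / sqrt (1 - 1 / 4)) ^ r)"
    using subgaussian_projection_mgf[OF sigma_finite_measure_axioms V _ _
      indep_bounded_subgaussian[OF ind bd E] e, of "\<lambda>_. 0"]
    by (intro mult_left_mono) (auto simp: G_def)
  also have "\<dots> \<le> ennreal (exp (- (1 / 2) * (r + 2 * t))) * ennreal (exp (real r / 2))"
    using const by (intro mult_left_mono ennreal_leI) auto
  also have "\<dots> = ennreal (exp (- t))"
    by (simp add: algebra_simps flip: ennreal_mult exp_add)
  finally show ?thesis
    unfolding G_def by (simp add: emeasure_eq_measure)
qed

section \<open>Gumbel noise and the logistic model\<close>

text \<open>Given \<open>S = s\<close>, the event has probability \<open>exp (- (q * s))\<close> by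
  the exponential tail of \<open>T\<close>; integrating against the density of \<open>S\<close>
  gives \<open>1 / (1 + q)\<close>.\<close>

lemma (in prob_space) exponential_race:
  assumes ind: "indep_var borel S borel T"
    and S: "distributed M lborel S (exponential_density 1)"
    and T: "distributed M lborel T (exponential_density 1)"
    and q: "q \<ge> 0"
  shows "prob {\<xi> \<in> space M. q * S \<xi> \<le> T \<xi>} = 1 / (1 + q)"
proof -
  have [measurable]: "random_variable borel S" "random_variable borel T"
    using ind indep_var_rv1 indep_var_rv2 by blast+
  interpret DT: prob_space "distr M borel T" by (rule prob_space_distr) simp
  let ?A = "{p. q * fst p \<le> (snd p :: real)}"
  have A[measurable]: "?A \<in> sets (borel \<Otimes>\<^sub>M borel)"
  proof -
    have "{p \<in> space (borel \<Otimes>\<^sub>M borel). q * fst p \<le> (snd p :: real)} \<in> sets (borel \<Otimes>\<^sub>M borel)"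
      by measurable
    then show ?thesis by (simp add: space_pair_measure)
  qed
  have tail: "emeasure M {\<xi> \<in> space M. x \<le> T \<xi>} = ennreal (exp (- x))" if "x \<ge> 0" for x
  proof -
    have "emeasure M {\<xi> \<in> space M. x \<le> T \<xi>} = (\<integral>\<^sup>+t. ennreal (exponential_density 1 t) * indicator {x..} t \<partial>lborel)"
      using distributed_emeasure[OF T, of "{x..}"] by (simp add: vimage_def Int_def conj_commute)
    also have "\<dots> = ennreal (0 - (- exp (- x)))"
    proof (rule nn_integral_FTC_atLeast)
      fix t :: real assume "x \<le> t"
      then show "DERIV (\<lambda>t. - exp (- t)) t :> exponential_density 1 t"
        using that by (auto intro!: derivative_eq_intros simp: erlang_density_def)
      show "0 \<le> exponential_density 1 t" by (simp add: erlang_density_def)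
    next
      show "((\<lambda>t::real. - exp (- t)) \<longlongrightarrow> 0) at_top"
        using tendsto_minus[OF filterlim_compose[OF exp_at_bot filterlim_uminus_at_bot_at_top]]
        by simp
    qed simp
    finally show ?thesis by simp
  qed
  have dS: "distr M borel S = density lborel (exponential_density 1)"
    using S by (simp add: distributed_def cong: distr_cong)
  have "emeasure M {\<xi> \<in> space M. q * S \<xi> \<le> T \<xi>}
      = emeasure (distr M (borel \<Otimes>\<^sub>M borel) (\<lambda>\<xi>. (S \<xi>, T \<xi>))) ?A"
    by (subst emeasure_distr) (auto intro!: arg_cong2[where f = emeasure])
  also have "\<dots> = emeasure (distr M borel S \<Otimes>\<^sub>M distr M borel T) ?A"
    using ind by (simp add: indep_var_distribution_eq)
  also have "\<dots> = (\<integral>\<^sup>+s. emeasure (distr M borel T) (Pair s -` ?A) \<partial>distr M borel S)"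
    by (rule DT.emeasure_pair_measure_alt) simp
  also have "\<dots> = (\<integral>\<^sup>+s. ennreal (exponential_density 1 s)
      * emeasure (distr M borel T) (Pair s -` ?A) \<partial>lborel)"
    unfolding dS by (intro nn_integral_density) measurable
  \<comment> \<open>The product of the tail and the density is recognised as a multiple of the
    exponential density of rate \<open>1 + q\<close>, whose total mass is known.\<close>
  also have "\<dots> = (\<integral>\<^sup>+s. ennreal (1 / (1 + q)) * ennreal (exponential_density (1 + q) s) \<partial>lborel)"
  proof (rule nn_integral_cong)
    fix s :: real
    show "ennreal (exponential_density 1 s) * emeasure (distr M borel T) (Pair s -` ?A)
        = ennreal (1 / (1 + q)) * ennreal (exponential_density (1 + q) s)"
    proof (cases "s < 0")
      case False
      have "emeasure (distr M borel T) (Pair s -` ?A) = emeasure M {\<xi> \<in> space M. q * s \<le> T \<xi>}"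
        by (subst emeasure_distr) (auto intro!: arg_cong2[where f = emeasure])
      also have "\<dots> = ennreal (exp (- (q * s)))"
        using tail[of "q * s"] False q by simp
      finally have em: "emeasure (distr M borel T) (Pair s -` ?A) = ennreal (exp (- (q * s)))" .
      have "exp (- s) * exp (- (q * s)) = exp ((- 1 - q) * s)"
        by (simp add: algebra_simps flip: exp_add)
      then have "exponential_density 1 s * exp (- (q * s)) = 1 / (1 + q) * exponential_density (1 + q) s"
        using False q by (simp add: erlang_density_def)
      moreover have "exponential_density 1 s \<ge> 0" "1 / (1 + q) \<ge> 0" 
        using q by (auto simp: erlang_density_def)
      ultimately show ?thesis
        unfolding em by (metis ennreal_mult')
    qed (simp add: erlang_density_def)
  qed
  also have "\<dots> = ennreal (1 / (1 + q))"
  proof -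
    have "prob_space (density lborel (exponential_density (1 + q)))"
      using q by (intro prob_space_exponential_density) auto
    then have "(\<integral>\<^sup>+s. ennreal (exponential_density (1 + q) s) \<partial>lborel) = 1"
      using prob_space.emeasure_space_1[of "density lborel (exponential_density (1 + q))"]
      by (simp add: emeasure_density)
    then show ?thesis by (simp add: nn_integral_cmult)
  qed
  finally show ?thesis using q by (simp add: emeasure_eq_measure)
qed

text \<open>The decreasing map \<open>exp (- x / \<sigma>)\<close> turns a lower tail into an upper
  tail of \<open>X\<close>, and the double exponential in the Gumbel distribution function collapses
  to \<open>exp (- a)\<close>.\<close>

lemma (in prob_space) exp_gumbel_exponential:
  assumes X[measurable]: "random_variable borel X" and \<sigma>: "\<sigma> > 0"
    and cdf: "cdf (distr M borel X) = gumbel_cdf 0 \<sigma>"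
  shows "distributed M lborel (\<lambda>\<xi>. exp (- X \<xi> / \<sigma>)) (exponential_density 1)"
proof (subst exponential_distributed_iff, simp, intro conjI allI impI)
  show "(\<lambda>\<xi>. exp (- X \<xi> / \<sigma>)) \<in> borel_measurable M" by measurable
next
  fix a :: real assume a: "0 \<le> a"
  have meas: "measure M {\<xi> \<in> space M. X \<xi> \<le> x} = exp (- exp (- x / \<sigma>))" for x
    using fun_cong[OF cdf, of x]
    by (simp add: cdf_def measure_distr gumbel_cdf_def vimage_def Int_def conj_commute)
  have cont: "isCont (cdf (distr M borel X)) x" for x
    unfolding cdf gumbel_cdf_def using \<sigma> by (intro continuous_intros) auto
  interpret DR: real_distribution "distr M borel X" by (rule real_distribution_distr) simp
  \<comment> \<open>Continuity of the distribution function excludes atoms, which allows passing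
    from \<open>X \<xi> \<le> x\<close> to \<open>X \<xi> < x\<close>.\<close>
  have null: "measure M {\<xi> \<in> space M. X \<xi> = x} = 0" for x
    using DR.isCont_cdf[of x] cont[of x]
    by (simp add: measure_distr vimage_def Int_def conj_commute)
  show "prob {\<xi> \<in> space M. exp (- X \<xi> / \<sigma>) \<le> a} = 1 - exp (- a * 1)"
  proof (cases "a = 0")
    case True
    then show ?thesis by (simp add: not_le[symmetric])
  next
    case False
    with a have a: "a > 0" by simp
    define x where "x = - \<sigma> * ln a"
    have iff: "exp (- X \<xi> / \<sigma>) \<le> a \<longleftrightarrow> \<not> X \<xi> < x" for \<xi>
    proof -
      have "exp (- X \<xi> / \<sigma>) \<le> a \<longleftrightarrow> - X \<xi> / \<sigma> \<le> ln a"
        using a by (metis exp_le_cancel_iff exp_ln)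
      also have "\<dots> \<longleftrightarrow> \<not> X \<xi> < x"
        using \<sigma> by (simp add: x_def field_simps not_less, linarith)
      finally show ?thesis .
    qed
    have "prob {\<xi> \<in> space M. X \<xi> \<le> x} = prob {\<xi> \<in> space M. X \<xi> < x} + prob {\<xi> \<in> space M. X \<xi> = x}"
      by (subst finite_measure_Union[symmetric]) (auto intro!: arg_cong[where f = prob])
    then have "prob {\<xi> \<in> space M. X \<xi> < x} = exp (- a)"
      using null[of x] meas[of x] a \<sigma> by (simp add: x_def)
    then show ?thesis
      unfolding iff using prob_neg[of "\<lambda>\<xi>. X \<xi> < x"] by simp
  qed
qed

text \<open>After the exponential transformation the comparison of the two noises is a race of unit
  exponentials with \<open>q = exp (- d / \<sigma>)\<close>.\<close>

lemma (in prob_space) gumbel_difference_logistic: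
  assumes ind: "indep_var borel X borel X'" and \<sigma>: "\<sigma> > 0"
    and cdf: "cdf (distr M borel X) = gumbel_cdf 0 \<sigma>" "cdf (distr M borel X') = gumbel_cdf 0 \<sigma>"
  shows "prob {\<xi> \<in> space M. X' \<xi> \<le> X \<xi> + d} = 1 / (1 + exp (- d / \<sigma>))"
proof -
  have [measurable]: "random_variable borel X" "random_variable borel X'"
    using ind indep_var_rv1 indep_var_rv2 by blast+
  have "indep_var borel ((\<lambda>x. exp (- x / \<sigma>)) \<circ> X) borel ((\<lambda>x. exp (- x / \<sigma>)) \<circ> X')"
    by (rule indep_var_compose[OF ind]) measurable
  then have "indep_var borel (\<lambda>\<xi>. exp (- X \<xi> / \<sigma>)) borel (\<lambda>\<xi>. exp (- X' \<xi> / \<sigma>))"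
    by (simp add: comp_def)
  then have "prob {\<xi> \<in> space M. exp (- d / \<sigma>) * exp (- X \<xi> / \<sigma>) \<le> exp (- X' \<xi> / \<sigma>)}
      = 1 / (1 + exp (- d / \<sigma>))"
    using cdf \<sigma> by (intro exponential_race exp_gumbel_exponential) auto
  moreover have "exp (- d / \<sigma>) * exp (- X \<xi> / \<sigma>) \<le> exp (- X' \<xi> / \<sigma>) \<longleftrightarrow> X' \<xi> \<le> X \<xi> + d" for \<xi>
    using \<sigma> mult_le_cancel_left_pos[OF \<sigma>, of "X' \<xi>" "d + X \<xi>"]
    by (simp add: field_simps flip: exp_add)
  ultimately show ?thesis by simp
qed

section \<open>Feasibility and optimality of the estimator\<close>

lemma sum_grid_nth:
  assumes "distinct y"
  shows "(\<Sum>j<length y. f (y ! j)) = sum f (set y)"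
  using sum.reindex_bij_betw[OF bij_betw_nth[OF assms refl refl], of f] .

lemma expectation_lottery:
  assumes y: "distinct y" and W: "set_pmf W \<subseteq> set y"
  shows "measure_pmf.expectation W f = (\<Sum>j<length y. pmf W (y ! j) * f (y ! j))"
proof -
  have "measure_pmf.expectation W f = (\<Sum>a\<in>set y. f a * pmf W a)"
    using W by (intro integral_measure_pmf_real) auto
  then show ?thesis
    using sum_grid_nth[OF y, of "\<lambda>a. f a * pmf W a"] by (simp add: mult.commute)
qed

lemma lottery_value_bounds:
  assumes y: "distinct y" and \<alpha>: "\<And>j. j < length y \<Longrightarrow> 0 \<le> \<alpha> j \<and> \<alpha> j \<le> \<gamma>" and \<gamma>: "0 \<le> \<gamma>"
  shows "0 \<le> (\<Sum>j<length y. pmf W (y ! j) * \<alpha> j)" "(\<Sum>j<length y. pmf W (y ! j) * \<alpha> j) \<le> \<gamma>"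
proof -
  show "0 \<le> (\<Sum>j<length y. pmf W (y ! j) * \<alpha> j)"
    using \<alpha> by (intro sum_nonneg mult_nonneg_nonneg) auto
  have "(\<Sum>j<length y. pmf W (y ! j) * \<alpha> j) \<le> (\<Sum>j<length y. pmf W (y ! j) * \<gamma>)"
    using \<alpha> by (intro sum_mono mult_left_mono) auto
  also have "\<dots> = measure_pmf.prob W (set y) * \<gamma>"
    using sum_grid_nth[OF y, of "pmf W"] by (simp add: measure_measure_pmf_finite sum_distrib_right[symmetric])
  also have "\<dots> \<le> 1 * \<gamma>" using \<gamma> by (intro mult_right_mono) auto
  finally show "(\<Sum>j<length y. pmf W (y ! j) * \<alpha> j) \<le> \<gamma>" by simp
qed

text \<open>Both lottery values lie in \<open>[0, \<gamma>]\<close>, hence so does the absolute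
  difference. With \<open>\<gamma> \<le> c\<close> this confines all logits to
  \<open>[- c, c]\<close>, where the curvature bound applies.\<close>

lemma pdiff_sum_bound:
  assumes y: "distinct y" and \<alpha>: "\<And>j. j < length y \<Longrightarrow> 0 \<le> \<alpha> j \<and> \<alpha> j \<le> \<gamma>" and \<gamma>: "0 \<le> \<gamma>"
  shows "\<bar>\<Sum>j<length y. pdiff y W Y k j * \<alpha> j\<bar> \<le> \<gamma>"
  using lottery_value_bounds[where \<alpha> = \<alpha> and W = "W k", OF y \<alpha> \<gamma>]
    lottery_value_bounds[where \<alpha> = \<alpha> and W = "Y k", OF y \<alpha> \<gamma>]
  unfolding pdiff_def left_diff_distrib sum_subtractf by linarith

lemma grid_props:
  assumes "b > 0" and lot: "\<And>k. k < K \<Longrightarrow> lottery b (W k)" "\<And>k. k < K \<Longrightarrow> lottery b (Y k)"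
  shows "set (grid b K W Y) = {0, b} \<union> (\<Union>k<K. set_pmf (W k)) \<union> (\<Union>k<K. set_pmf (Y k))"
    and "sorted_wrt (<) (grid b K W Y)"
    and "set (grid b K W Y) \<subseteq> {0..b}"
    and "length (grid b K W Y) \<ge> 2"
    and "grid b K W Y ! 0 = 0"
    and "grid b K W Y ! (length (grid b K W Y) - 1) = b"
proof -
  let ?y = "grid b K W Y"
  have fin: "finite ({0, b} \<union> (\<Union>k<K. set_pmf (W k)) \<union> (\<Union>k<K. set_pmf (Y k)))"
    using lot by (auto simp: lottery_def)
  show set: "set ?y = {0, b} \<union> (\<Union>k<K. set_pmf (W k)) \<union> (\<Union>k<K. set_pmf (Y k))"
    using fin unfolding grid_def by (rule set_sorted_list_of_set)
  show sorted: "sorted_wrt (<) ?y"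
    unfolding grid_def by (rule strict_sorted_list_of_set)
  show sub: "set ?y \<subseteq> {0..b}"
    unfolding set using lot \<open>b > 0\<close> by (auto simp: lottery_def)
  have "card {0, b} \<le> card (set ?y)"
    by (rule card_mono) (auto simp: set[symmetric], auto simp: set)
  then show len: "length ?y \<ge> 2"
    using \<open>b > 0\<close> card_length[of ?y] by simp
  have mono: "?y ! i \<le> ?y ! j" if "i \<le> j" "j < length ?y" for i j
    using sorted that by (cases "i = j") (auto simp: sorted_wrt_iff_nth_less intro: less_imp_le)
  have in0: "0 \<in> set ?y" and inb: "b \<in> set ?y" by (auto simp: set)
  from in0 obtain i where i: "i < length ?y" "?y ! i = 0" by (auto simp: in_set_conv_nth)
  have "?y ! 0 \<in> set ?y" using len by (intro nth_mem) auto
  with sub have "?y ! 0 \<ge> 0" by auto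
  with mono[of 0 i] i show "?y ! 0 = 0" by auto
  from inb obtain i where i: "i < length ?y" "?y ! i = b" by (auto simp: in_set_conv_nth)
  have "?y ! (length ?y - 1) \<in> set ?y" using len by (intro nth_mem) auto
  with sub have "?y ! (length ?y - 1) \<le> b" by auto
  with mono[of i "length ?y - 1"] i show "?y ! (length ?y - 1) = b" by auto
qed

text \<open>The slopes decrease and the last one is nonnegative, so all are; thus
  \<open>\<alpha>\<close> increases from 0 to \<open>\<gamma>\<close>.\<close>

lemma mle_feasible_bounds:
  assumes feas: "mle_feasible y L c \<alpha> \<beta> \<gamma>" and y: "sorted_wrt (<) y" "length y \<ge> 2"
    and j: "j < length y"
  shows "0 \<le> \<alpha> $ j" "\<alpha> $ j \<le> \<gamma>"
proof -
  define N where "N = length y"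
  have N: "N \<ge> 2" using y by (simp add: N_def)
  have step: "\<And>j. j < N - 1 \<Longrightarrow> \<beta> $ j = (\<alpha> $ (j + 1) - \<alpha> $ j) / (y ! (j + 1) - y ! j)"
    and anti: "\<And>j. j < N - 2 \<Longrightarrow> \<beta> $ (j + 1) \<le> \<beta> $ j"
    and last: "\<beta> $ (N - 2) \<ge> 0" and a0: "\<alpha> $ 0 = 0" and aN: "\<alpha> $ (N - 1) = \<gamma>"
    using feas by (auto simp: mle_feasible_def Let_def N_def)
  have b: "\<beta> $ j \<ge> 0" if "j \<le> N - 2" for j
    using that
  proof (induction j rule: inc_induct)
    case base
    then show ?case using last by simp
  next
    case (step j)
    then show ?case using anti[of j] by simp
  qed
  have mono: "\<alpha> $ j \<le> \<alpha> $ Suc j" if j: "j < N - 1" for j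
  proof -
    have "y ! j < y ! Suc j"
      using y(1) j by (auto simp: sorted_wrt_iff_nth_less N_def)
    moreover have "\<beta> $ j \<ge> 0" using b[of j] j by simp
    ultimately show ?thesis using step[OF j] by (simp add: zero_le_divide_iff)
  qed
  have jN: "j \<le> N - 1" using j by (simp add: N_def)
  then show "0 \<le> \<alpha> $ j"
  proof (induction j)
    case (Suc j)
    then show ?case using mono[of j] by simp
  qed (use a0 in simp)
  from jN show "\<alpha> $ j \<le> \<gamma>"
  proof (induction j rule: inc_induct)
    case (step j)
    then show ?case using mono[of j] by simp
  qed (use aN in simp)
qed

text \<open>Makes the scaled true utility a competitor in the maximisation. Concavity orders the
  slopes, the Lipschitz bound controls the first one, and monotonicity makes the last one
  nonnegative.\<close>

lemma utility_mle_feasible: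
  fixes y :: "real list"
  defines "N \<equiv> length y"
  assumes u: "u \<in> utility_class b L"
    and y: "sorted_wrt (<) y" "set y \<subseteq> {0..b}" "N \<ge> 2" "y ! 0 = 0" "y ! (N - 1) = b"
    and \<gamma>: "0 \<le> \<gamma>" "\<gamma> \<le> c"
  shows "mle_feasible y L c (\<gamma> \<cdot>\<^sub>v vec N (\<lambda>j. u (y ! j)))
     (vec (N - 1) (\<lambda>j. \<gamma> * ((u (y ! (j + 1)) - u (y ! j)) / (y ! (j + 1) - y ! j)))) \<gamma>"
proof -
  have mono: "mono_on {0..b} u" and conc: "concave_on {0..b} u" and lip: "L-lipschitz_on {0..b} u"
    and u0: "u 0 = 0" and ub: "u b = 1"
    using u by (auto simp: utility_class_def)
  have mem: "y ! j \<in> {0..b}" if "j < N" for j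
    using subsetD[OF y(2) nth_mem[of j y]] that by (simp add: N_def)
  have less: "y ! i < y ! j" if "i < j" "j < N" for i j
    using y(1) that by (auto simp: sorted_wrt_iff_nth_less N_def)
  have slope: "(u (y ! (j + 1 + 1)) - u (y ! (j + 1))) / (y ! (j + 1 + 1) - y ! (j + 1))
      \<le> (u (y ! (j + 1)) - u (y ! j)) / (y ! (j + 1) - y ! j)" if j: "j < N - 2" for j
  proof -
    have cx: "convex_on {0..b} (\<lambda>x. - u x)" using conc by (simp add: concave_on_def)
    have l: "y ! j < y ! (j + 1)" "y ! (j + 1) < y ! (j + 1 + 1)" using less j by auto
    have m: "y ! j \<in> {0..b}" "y ! (j + 1 + 1) \<in> {0..b}" using mem j by auto
    \<comment> \<open>The slope inequality for the convex function \<open>- u\<close> has reversed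
      differences; this identity restores the slopes of \<open>u\<close> up to one sign.\<close>
    have eq: "(- p - (- q)) / (r - s) = - ((q - p) / (s - r))" for p q r s :: real
      using minus_divide_divide[of "p - q" "s - r"] minus_divide_left[of "q - p" "s - r"] by simp
    have "(- u (y ! j) - (- u (y ! (j + 1)))) / (y ! j - y ! (j + 1))
       \<le> (- u (y ! (j + 1)) - (- u (y ! (j + 1 + 1)))) / (y ! (j + 1) - y ! (j + 1 + 1))"
      using convex_on_slope_le[OF cx m l] by (rule order_trans)
    then show ?thesis unfolding eq neg_le_iff_le .
  qed
  have first: "(u (y ! 1) - u (y ! 0)) / (y ! 1 - y ! 0) \<le> L"
  proof -
    have "dist (u (y ! 1)) (u (y ! 0)) \<le> L * dist (y ! 1) (y ! 0)"
      using lip mem y(3) by (intro lipschitz_onD) auto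
    then show ?thesis using less[of 0 1] y(3) by (simp add: divide_le_eq dist_real_def)
  qed
  have last: "(u (y ! (N - 1)) - u (y ! (N - 2))) / (y ! (N - 1) - y ! (N - 2)) \<ge> 0"
  proof -
    have lt: "y ! (N - 2) < y ! (N - 1)" using y(3) by (intro less) auto
    have "u (y ! (N - 2)) \<le> u (y ! (N - 1))"
      using y(3) less_imp_le[OF lt] by (intro mono_onD[OF mono] mem) auto
    then show ?thesis using lt by simp
  qed
  show ?thesis
    unfolding mle_feasible_def Let_def N_def[symmetric]
  proof (intro conjI allI impI)
    fix j assume j: "j < N - 2"
    show "vec (N - 1) (\<lambda>j. \<gamma> * ((u (y ! (j + 1)) - u (y ! j)) / (y ! (j + 1) - y ! j))) $ (j + 1)
      \<le> vec (N - 1) (\<lambda>j. \<gamma> * ((u (y ! (j + 1)) - u (y ! j)) / (y ! (j + 1) - y ! j))) $ j"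
      using mult_left_mono[OF slope[OF j] \<gamma>(1)] j by simp
  next
    show "vec (N - 1) (\<lambda>j. \<gamma> * ((u (y ! (j + 1)) - u (y ! j)) / (y ! (j + 1) - y ! j))) $ 0 \<le> L * \<gamma>"
      using mult_left_mono[OF first \<gamma>(1)] y(3) by (simp add: mult.commute)
  next
    have "N - 2 + 1 = N - 1" using y(3) by simp
    then show "0 \<le> vec (N - 1) (\<lambda>j. \<gamma> * ((u (y ! (j + 1)) - u (y ! j)) / (y ! (j + 1) - y ! j))) $ (N - 2)"
      using mult_nonneg_nonneg[OF \<gamma>(1) last] y(3) by simp
  qed (use \<gamma> y u0 ub in \<open>auto simp: right_diff_distrib\<close>)
qed

text \<open>The logistic likelihood has score \<open>v k\<close> at the truth and curvature at least
  \<open>1 / (2 + 2 exp c)\<close> on the feasible set.\<close>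

lemma mle_basic_inequality:
  fixes z :: "nat \<Rightarrow> real"
  assumes mle: "is_mle y K W Y L c z \<alpha> \<beta> \<gamma>" and true: "mle_feasible y L c \<alpha>' \<beta>' \<gamma>'"
    and y: "sorted_wrt (<) y" "length y \<ge> 2"
    and z: "\<And>k. k < K \<Longrightarrow> z k = 1 \<or> z k = - 1"
  defines "D \<equiv> \<lambda>k. \<Sum>j<length y. pdiff y W Y k j * (\<alpha> $ j - \<alpha>' $ j)"
  defines "v \<equiv> \<lambda>k. (if z k = 1 then 1 else 0)
      - 1 / (1 + exp (- (\<Sum>j<length y. pdiff y W Y k j * \<alpha>' $ j)))"
  shows "1 / (2 + 2 * exp c) / 2 * (\<Sum>k<K. (D k)\<^sup>2) \<le> (\<Sum>k<K. v k * D k)"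
proof -
  define p where "p k = (\<Sum>j<length y. pdiff y W Y k j * \<alpha> $ j)" for k
  define p' where "p' k = (\<Sum>j<length y. pdiff y W Y k j * \<alpha>' $ j)" for k
  have dist: "distinct y" using y(1) strict_sorted_iff by blast
  have feas: "mle_feasible y L c \<alpha> \<beta> \<gamma>" and
    opt: "log_likelihood y K W Y z \<alpha>' \<le> log_likelihood y K W Y z \<alpha>"
    using mle true by (auto simp: is_mle_def is_arg_max_linorder)
  have \<gamma>: "0 \<le> \<gamma>" "\<gamma> \<le> c" "0 \<le> \<gamma>'" "\<gamma>' \<le> c"
    using feas true by (auto simp: mle_feasible_def Let_def)
  have p: "\<bar>p k\<bar> \<le> c" "\<bar>p' k\<bar> \<le> c" for k
    using pdiff_sum_bound[where \<alpha> = "\<lambda>j. \<alpha> $ j", OF dist _ \<gamma>(1), of W Y k]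
      mle_feasible_bounds[OF feas y] \<gamma>(2)
      pdiff_sum_bound[where \<alpha> = "\<lambda>j. \<alpha>' $ j", OF dist _ \<gamma>(3), of W Y k]
      mle_feasible_bounds[OF true y] \<gamma>(4)
    by (force simp: p_def p'_def)+
  have D: "D k = p k - p' k" for k
    by (simp add: D_def p_def p'_def right_diff_distrib sum_subtractf)
  have ll: "log_likelihood y K W Y z a
      = - (\<Sum>k<K. ln (1 + exp (- z k * (\<Sum>j<length y. pdiff y W Y k j * a $ j))))" for a
    by (simp add: log_likelihood_def sum_distrib_left sum_negf mult.assoc)
  \<comment> \<open>For \<open>z k = 1\<close> the loss is expanded at \<open>- p' k\<close>, for
    \<open>z k = - 1\<close> at \<open>p' k\<close>. In both cases the linear coefficient in
    \<open>D k\<close> is \<open>- v k\<close>, in the first one by the symmetry \<open>neg\<close>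
    of the logistic function.\<close>
  have taylor: "1 / (2 + 2 * exp c) / 2 * (D k)\<^sup>2 - v k * D k
      \<le> ln (1 + exp (- z k * p k)) - ln (1 + exp (- z k * p' k))" if k: "k < K" for k
  proof -
    have neg: "- x / (1 + exp s) = - x + x / (1 + exp (- s))" for x s :: real
      by (simp add: divide_simps exp_minus add_pos_pos add_nonneg_eq_0_iff) (simp add: algebra_simps)
    from z[OF k] show ?thesis
    proof
      assume z: "z k = 1"
      then have vk: "v k = 1 - 1 / (1 + exp (- p' k))" by (simp add: v_def p'_def)
      have sq: "(- p k - (- p' k))\<^sup>2 = (D k)\<^sup>2"
        by (simp add: D power2_commute)
      have lin: "(- p k - (- p' k)) / (1 + exp (- (- p' k))) = - (v k * D k)"
        using neg[of "D k" "p' k"] by (simp add: D vk left_diff_distrib)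
      show ?thesis
        using softplus_quadratic_lower_bound[of "- p' k" c "- p k"] p[of k]
        unfolding sq lin by (simp add: z)
    next
      assume z: "z k = - 1"
      show ?thesis
        using softplus_quadratic_lower_bound[of "p' k" c "p k"] p[of k]
        by (simp add: z v_def p'_def[symmetric] D)
    qed
  qed
  have "1 / (2 + 2 * exp c) / 2 * (\<Sum>k<K. (D k)\<^sup>2) - (\<Sum>k<K. v k * D k)
      = (\<Sum>k<K. 1 / (2 + 2 * exp c) / 2 * (D k)\<^sup>2 - v k * D k)"
    by (simp only: sum_subtractf sum_distrib_left)
  also have "\<dots> \<le> (\<Sum>k<K. ln (1 + exp (- z k * p k)) - ln (1 + exp (- z k * p' k)))"
    using taylor by (intro sum_mono) auto
  also have "\<dots> \<le> 0"
    using opt by (simp add: ll p_def p'_def sum_subtractf)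
  finally show ?thesis by simp
qed

section \<open>Projection inequality, quadratic form of the seminorm and column space of
  \<open>P\<close>\<close>

text \<open>Pairing with \<open>D\<close> sees only the coordinates of \<open>v\<close> along the
  family. Cauchy-Schwarz is applied to these coordinates and the coefficients of \<open>D\<close>,
  whose norm equals that of \<open>D\<close> by Parseval.\<close>

lemma sum_mult_le_projection:
  fixes v D :: "nat \<Rightarrow> real"
  assumes e: "orthonormal K e r" and D: "\<And>k. k < K \<Longrightarrow> D k = (\<Sum>i<r. a i * e i k)"
  shows "(\<Sum>k<K. v k * D k) \<le> sqrt (\<Sum>i<r. (\<Sum>k<K. e i k * v k)\<^sup>2) * sqrt (\<Sum>k<K. (D k)\<^sup>2)"
proof -
  have "(\<Sum>k<K. v k * D k) = (\<Sum>k<K. \<Sum>i<r. a i * (e i k * v k))"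
    using D by (simp add: sum_distrib_left mult_ac)
  also have "\<dots> = (\<Sum>i<r. (\<Sum>k<K. e i k * v k) * a i)"
    by (subst sum.swap) (simp add: sum_distrib_left sum_distrib_right mult_ac)
  also have "\<dots> \<le> sqrt (\<Sum>i<r. (\<Sum>k<K. e i k * v k)\<^sup>2) * sqrt (\<Sum>i<r. (a i)\<^sup>2)"
    unfolding real_sqrt_mult[symmetric] by (rule real_le_rsqrt, rule Cauchy_Schwarz_ineq_sum)
  also have "(\<Sum>i<r. (a i)\<^sup>2) = (\<Sum>k<K. (D k)\<^sup>2)"
  proof -
    have "(D k)\<^sup>2 = (\<Sum>i<r. \<Sum>j<r. a i * a j * (e i k * e j k))" if "k < K" for k
      unfolding D[OF that] power2_eq_square sum_product by (simp add: mult_ac)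
    then have "(\<Sum>k<K. (D k)\<^sup>2) = (\<Sum>k<K. \<Sum>i<r. \<Sum>j<r. a i * a j * (e i k * e j k))"
      by simp
    also have "\<dots> = (\<Sum>i<r. \<Sum>k<K. \<Sum>j<r. a i * a j * (e i k * e j k))"
      by (rule sum.swap)
    also have "\<dots> = (\<Sum>i<r. \<Sum>j<r. \<Sum>k<K. a i * a j * (e i k * e j k))"
      by (rule sum.cong[OF refl], rule sum.swap)
    also have "\<dots> = (\<Sum>i<r. \<Sum>j<r. a i * a j * (\<Sum>k<K. e i k * e j k))"
      by (simp add: sum_distrib_left)
    also have "\<dots> = (\<Sum>i<r. \<Sum>j<r. a i * a j * (if i = j then 1 else 0))"
      using e by (intro sum.cong refl) (auto simp: orthonormal_def)
    finally show ?thesis by (simp add: power2_eq_square if_distrib cong: if_cong)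
  qed
  finally show ?thesis .
qed

text \<open>\<open>Q_mat\<close> deletes coordinate 0, so the form is that of
  \<open>Sigma_D + lam I\<close> on the remaining ones. Because \<open>x $ 0 = 0\<close>, the inner
  sum may run over the whole grid.\<close>

lemma quadratic_form_grid:
  fixes x :: "real vec" and y :: "real list"
  defines "N \<equiv> length y"
  assumes x: "x \<in> carrier_vec N" "x $ 0 = 0" and N: "N \<ge> 1"
  shows "x \<bullet> ((transpose_mat (Q_mat N) * (Sigma_D y K W Y + lam \<cdot>\<^sub>m 1\<^sub>m (N - 1)) * Q_mat N) *\<^sub>v x)
     = (\<Sum>k<K. (\<Sum>j<N. pdiff y W Y k j * x $ j)\<^sup>2) / real K + lam * (\<Sum>j=1..<N. (x $ j)\<^sup>2)"
proof -
  have split: "(\<Sum>i<N. f i) = f 0 + (\<Sum>i<N - 1. f (i + 1))" for f :: "nat \<Rightarrow> real"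
    using sum.lessThan_Suc_shift[of f "N - 1"] N by simp
  let ?Q = "Q_mat N" and ?P = "P_mat y K W Y" and ?S = "Sigma_D y K W Y"
  define w where "w = ?Q *\<^sub>v x"
  have Q: "?Q \<in> carrier_mat (N - 1) N" by (simp add: Q_mat_def)
  have P: "?P \<in> carrier_mat K (N - 1)" by (simp add: P_mat_def N_def)
  have S: "?S \<in> carrier_mat (N - 1) (N - 1)" using P by (simp add: Sigma_D_def)
  have w: "w \<in> carrier_vec (N - 1)" using Q by (simp add: w_def carrier_vecI)
  have w_i: "w $ i = x $ (i + 1)" if "i < N - 1" for i
  proof -
    have "w $ i = (\<Sum>j<N. (if j = i + 1 then 1 else 0) * x $ j)"
      using that x(1) by (simp add: w_def Q_mat_def scalar_prod_def atLeast0LessThan)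
    also have "\<dots> = x $ (i + 1)"
      using that by (subst sum.remove[of _ "i + 1"]) auto
    finally show ?thesis .
  qed
  have smult: "(s \<cdot>\<^sub>m A) *\<^sub>v z = s \<cdot>\<^sub>v (A *\<^sub>v z)" if "A \<in> carrier_mat n m" "z \<in> carrier_vec m"
    for s :: real and A n m z
    using that by (intro eq_vecI) (auto simp: scalar_prod_def sum_distrib_left mult.assoc)
  have Sw: "w \<bullet> (?S *\<^sub>v w) = (\<Sum>k<K. (\<Sum>j<N. pdiff y W Y k j * x $ j)\<^sup>2) / real K"
  proof -
    have PTP: "transpose_mat ?P * ?P \<in> carrier_mat (N - 1) (N - 1)" using P by simp
    have Pw: "?P *\<^sub>v w \<in> carrier_vec K" using P by (simp add: carrier_vecI)
    have "?S *\<^sub>v w = (1 / real K) \<cdot>\<^sub>v (transpose_mat ?P *\<^sub>v (?P *\<^sub>v w))"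
      unfolding Sigma_D_def smult[OF PTP w] using P w by (subst assoc_mult_mat_vec) auto
    then have "w \<bullet> (?S *\<^sub>v w) = (1 / real K) * (w \<bullet> (transpose_mat ?P *\<^sub>v (?P *\<^sub>v w)))"
      using w P Pw by (subst (2) scalar_prod_def, simp add: scalar_prod_def sum_distrib_left mult_ac)
    also have "w \<bullet> (transpose_mat ?P *\<^sub>v (?P *\<^sub>v w)) = (?P *\<^sub>v w) \<bullet> (?P *\<^sub>v w)"
      using transpose_vec_mult_scalar[OF P w Pw] w P Pw
      by (subst comm_scalar_prod[OF w]) auto
    also have "\<dots> = (\<Sum>k<K. (\<Sum>j<N. pdiff y W Y k j * x $ j)\<^sup>2)"
    proof -
      have "(?P *\<^sub>v w) $ k = (\<Sum>j<N. pdiff y W Y k j * x $ j)" if "k < K" for k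
      proof -
        have "(?P *\<^sub>v w) $ k = (\<Sum>j<N - 1. pdiff y W Y k (j + 1) * w $ j)"
          using that w by (simp add: P_mat_def scalar_prod_def atLeast0LessThan N_def)
        then show ?thesis using w_i x(2) by (simp add: split)
      qed
      then show ?thesis
        using P by (simp add: scalar_prod_def atLeast0LessThan power2_eq_square)
    qed
    finally show ?thesis by simp
  qed
  have Iw: "w \<bullet> ((lam \<cdot>\<^sub>m 1\<^sub>m (N - 1)) *\<^sub>v w) = lam * (\<Sum>j=1..<N. (x $ j)\<^sup>2)"
  proof -
    have "w \<bullet> ((lam \<cdot>\<^sub>m 1\<^sub>m (N - 1)) *\<^sub>v w) = lam * (\<Sum>i<N - 1. (x $ (i + 1))\<^sup>2)"
      using w w_i smult[OF one_carrier_mat w, of lam]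
      by (simp add: scalar_prod_def atLeast0LessThan power2_eq_square sum_distrib_left mult_ac)
    also have "(\<Sum>i<N - 1. (x $ (i + 1))\<^sup>2) = (\<Sum>j=1..<N. (x $ j)\<^sup>2)"
      using N sum.shift_bounds_nat_ivl[of "\<lambda>j. (x $ j)\<^sup>2" 0 1 "N - 1"]
      by (simp add: atLeast0LessThan)
    finally show ?thesis .
  qed
  define B where "B = ?S + lam \<cdot>\<^sub>m 1\<^sub>m (N - 1)"
  have B: "B \<in> carrier_mat (N - 1) (N - 1)" using S by (simp add: B_def)
  have Bw: "B *\<^sub>v w \<in> carrier_vec (N - 1)" using B by (simp add: carrier_vecI)
  have "(transpose_mat ?Q * B * ?Q) *\<^sub>v x = transpose_mat ?Q *\<^sub>v (B *\<^sub>v w)"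
    using Q B x(1) w
    by (subst assoc_mult_mat_vec[of _ N "N - 1" _ N])
       (auto simp: w_def[symmetric] intro!: assoc_mult_mat_vec[of _ N "N - 1" _ "N - 1"])
  then have "x \<bullet> ((transpose_mat ?Q * B * ?Q) *\<^sub>v x) = (B *\<^sub>v w) \<bullet> w"
    using transpose_vec_mult_scalar[OF Q x(1) Bw] Q Bw
    by (subst comm_scalar_prod[OF x(1)]) (auto simp: w_def)
  also have "\<dots> = w \<bullet> (B *\<^sub>v w)" by (rule comm_scalar_prod[OF Bw w])
  also have "B *\<^sub>v w = ?S *\<^sub>v w + (lam \<cdot>\<^sub>m 1\<^sub>m (N - 1)) *\<^sub>v w"
    unfolding B_def using S w by (intro add_mult_distrib_mat_vec) auto
  also have "w \<bullet> (?S *\<^sub>v w + (lam \<cdot>\<^sub>m 1\<^sub>m (N - 1)) *\<^sub>v w)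
      = w \<bullet> (?S *\<^sub>v w) + w \<bullet> ((lam \<cdot>\<^sub>m 1\<^sub>m (N - 1)) *\<^sub>v w)"
    using w S by (intro scalar_prod_add_distrib[of _ "N - 1"]) (auto intro: carrier_vecI)
  finally show ?thesis unfolding Sw Iw B_def .
qed

lemma span_sum:
  fixes e :: "nat \<Rightarrow> nat \<Rightarrow> real"
  assumes "\<And>j. j < n \<Longrightarrow> \<exists>a. \<forall>k<K. x j k = (\<Sum>i<r. a i * e i k)"
  shows "\<exists>a. \<forall>k<K. (\<Sum>j<n. d j * x j k) = (\<Sum>i<r. a i * e i k)"
proof -
  from assms obtain a where a: "\<And>j k. j < n \<Longrightarrow> k < K \<Longrightarrow> x j k = (\<Sum>i<r. a j i * e i k)"
    by metis
  show ?thesis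
  proof (intro exI allI impI)
    fix k assume k: "k < K"
    have "(\<Sum>j<n. d j * x j k) = (\<Sum>j<n. \<Sum>i<r. d j * a j i * e i k)"
      using a k by (simp add: sum_distrib_left mult.assoc)
    also have "\<dots> = (\<Sum>i<r. (\<Sum>j<n. d j * a j i) * e i k)"
      by (subst sum.swap) (simp add: sum_distrib_right)
    finally show "(\<Sum>j<n. d j * x j k) = (\<Sum>i<r. (\<Sum>j<n. d j * a j i) * e i k)" .
  qed
qed

text \<open>Gram-Schmidt applied to the columns selected by the rank lemma. This is where the
  dimension in the tail bound becomes the rank of \<open>Sigma_D\<close>.\<close>

lemma orthonormal_family_spanning_columns:
  obtains r e where "r \<le> vec_space.rank (length y - 1) (Sigma_D y K W Y)" "orthonormal K e r"
    "\<And>d. \<exists>a. \<forall>k<K. (\<Sum>j<length y - 1. d j * pdiff y W Y k (j + 1)) = (\<Sum>i<r. a i * e i k)"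
proof (cases "K = 0")
  \<comment> \<open>Without observations the factor \<open>1 / real K\<close> is zero and the rank
    lemma does not apply; the empty family serves.\<close>
  case True
  then show ?thesis by (intro that[of 0]) (auto simp: orthonormal_def)
next
  case False
  define n where "n = length y - 1"
  let ?P = "P_mat y K W Y"
  have P: "?P \<in> carrier_mat K n" by (simp add: P_mat_def n_def)
  have s: "1 / real K \<noteq> 0" using False by simp
  obtain f where f: "\<And>i. i < vec_space.rank n (Sigma_D y K W Y) \<Longrightarrow> f i < n"
    and cols: "\<And>j. j < n \<Longrightarrow> \<exists>a. \<forall>k<K. ?P $$ (k, j)
      = (\<Sum>i<vec_space.rank n (Sigma_D y K W Y). a i * ?P $$ (k, f i))"
    using rank_gram_spanning_columns[OF P s, folded Sigma_D_def] by blast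
  obtain r e where r: "r \<le> vec_space.rank n (Sigma_D y K W Y)" "orthonormal K e r"
    and e: "\<And>i. i < vec_space.rank n (Sigma_D y K W Y) \<Longrightarrow>
      \<exists>a. \<forall>k<K. ?P $$ (k, f i) = (\<Sum>l<r. a l * e l k)"
    by (rule gram_schmidt_functions[where x = "\<lambda>i k. ?P $$ (k, f i)" and K = K
        and m = "vec_space.rank n (Sigma_D y K W Y)"]) blast
  have colj: "\<exists>a. \<forall>k<K. ?P $$ (k, j) = (\<Sum>i<r. a i * e i k)" if j: "j < n" for j
  proof -
    from cols[OF j] obtain d where d: "\<And>k. k < K \<Longrightarrow> ?P $$ (k, j)
      = (\<Sum>i<vec_space.rank n (Sigma_D y K W Y). d i * ?P $$ (k, f i))" by blast
    from span_sum[where x = "\<lambda>i k. ?P $$ (k, f i)", OF e, of _ d]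
    obtain a where "\<And>k. k < K \<Longrightarrow> (\<Sum>i<vec_space.rank n (Sigma_D y K W Y). d i * ?P $$ (k, f i))
      = (\<Sum>i<r. a i * e i k)" by blast
    with d show ?thesis by (intro exI[of _ a]) simp
  qed
  have "\<exists>a. \<forall>k<K. (\<Sum>j<n. d j * ?P $$ (k, j)) = (\<Sum>i<r. a i * e i k)" for d
    by (rule span_sum[OF colj])
  moreover have "(\<Sum>j<n. d j * ?P $$ (k, j)) = (\<Sum>j<n. d j * pdiff y W Y k (j + 1))"
    if "k < K" for d k
    using that by (simp add: P_mat_def n_def)
  ultimately have "\<exists>a. \<forall>k<K. (\<Sum>j<n. d j * pdiff y W Y k (j + 1)) = (\<Sum>i<r. a i * e i k)" for d
    by simp
  then show ?thesis using that r unfolding n_def by blast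
qed

section \<open>Measurability and the deterministic error bound\<close>

text \<open>A condition that depends only on which of finitely many events occur is a finite union
  of cells, for arbitrary \<open>\<Psi>\<close>. This covers conditions quantifying over all
  maximisers without any measurable choice of one.\<close>

lemma sets_Collect_finite_pattern:
  assumes I: "finite I" and P: "\<And>k. k \<in> I \<Longrightarrow> {\<xi> \<in> space M. P k \<xi>} \<in> sets M"
  shows "{\<xi> \<in> space M. \<Psi> {k \<in> I. P k \<xi>}} \<in> sets M"
proof -
  have "{\<xi> \<in> space M. \<Psi> {k \<in> I. P k \<xi>}}
      = (\<Union>S\<in>{S \<in> Pow I. \<Psi> S}. {\<xi> \<in> space M. \<forall>k\<in>I. P k \<xi> \<longleftrightarrow> k \<in> S})"
  proof (intro equalityI subsetI)
    fix \<xi> assume "\<xi> \<in> {\<xi> \<in> space M. \<Psi> {k \<in> I. P k \<xi>}}"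
    then show "\<xi> \<in> (\<Union>S\<in>{S \<in> Pow I. \<Psi> S}. {\<xi> \<in> space M. \<forall>k\<in>I. P k \<xi> \<longleftrightarrow> k \<in> S})"
      by (intro UN_I[of "{k \<in> I. P k \<xi>}"]) auto
  next
    fix \<xi> assume "\<xi> \<in> (\<Union>S\<in>{S \<in> Pow I. \<Psi> S}. {\<xi> \<in> space M. \<forall>k\<in>I. P k \<xi> \<longleftrightarrow> k \<in> S})"
    then obtain S where S: "S \<subseteq> I" "\<Psi> S" "\<xi> \<in> space M" "\<forall>k\<in>I. P k \<xi> \<longleftrightarrow> k \<in> S" by auto
    then have "{k \<in> I. P k \<xi>} = S" by auto
    with S show "\<xi> \<in> {\<xi> \<in> space M. \<Psi> {k \<in> I. P k \<xi>}}" by simp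
  qed
  also have "\<dots> \<in> sets M"
  proof (rule sets.finite_UN)
    fix S
    show "{\<xi> \<in> space M. \<forall>k\<in>I. P k \<xi> \<longleftrightarrow> k \<in> S} \<in> sets M"
    proof (rule sets.sets_Collect_finite_All[OF _ I])
      fix k assume k: "k \<in> I"
      show "{\<xi> \<in> space M. P k \<xi> \<longleftrightarrow> k \<in> S} \<in> sets M"
        using P[OF k] sets.sets_Collect_neg[OF P[OF k]] by (cases "k \<in> S") simp_all
    qed
  qed (use I in simp)
  finally show ?thesis .
qed

text \<open>For \<open>S > 0\<close>, dividing by \<open>sqrt S\<close> gives
  \<open>w / 2 * sqrt S \<le> sqrt g\<close>, which is then squared.\<close>

lemma square_le_of_quadratic:
  fixes S g w :: real
  assumes w: "w > 0" and g: "g \<ge> 0" and S: "S \<ge> 0" and le: "w / 2 * S \<le> sqrt g * sqrt S"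
  shows "S \<le> 4 * g / w\<^sup>2"
proof (cases "S = 0")
  case False
  with S have pos: "sqrt S > 0" by simp
  have "w / 2 * sqrt S * sqrt S = w / 2 * S" using S by (simp add: mult.assoc)
  with le have "w / 2 * sqrt S * sqrt S \<le> sqrt g * sqrt S" by (simp only:)
  with pos have "w / 2 * sqrt S \<le> sqrt g" by (simp only: mult_le_cancel_right_pos)
  then have "(w / 2 * sqrt S)\<^sup>2 \<le> (sqrt g)\<^sup>2" using w S by (intro power_mono) auto
  then have "w\<^sup>2 * S \<le> 4 * g" using S g by (simp add: power_mult_distrib power_divide)
  then show ?thesis using w by (simp add: pos_le_divide_eq mult.commute)
qed (use g in simp)

text \<open>The square of the right-hand side is \<open>2 * C + Y\<close> plus twice the product of
  the roots, and that product is at least \<open>C\<close>. This brings the error bound into its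
  two-root form.\<close>

lemma sqrt_le_sqrt_add_sqrt:
  fixes X C Y :: real
  assumes "X \<le> 4 * C + Y" "C \<ge> 0" "Y \<ge> 0"
  shows "sqrt X \<le> sqrt C + sqrt (C + Y)"
proof (rule real_le_lsqrt)
  have "C = sqrt C * sqrt C" using assms by simp
  also have "\<dots> \<le> sqrt C * sqrt (C + Y)" using assms by (intro mult_left_mono) auto
  finally have "4 * C + Y \<le> (sqrt C + sqrt (C + Y))\<^sup>2"
    using assms by (simp add: power2_sum)
  with assms show "X \<le> (sqrt C + sqrt (C + Y))\<^sup>2" by simp
qed (use assms in simp)

lemma is_mle_cong:
  assumes z: "\<And>k. k < K \<Longrightarrow> z k = z' k"
  shows "is_mle y K W Y L c z \<alpha> \<beta> \<gamma> \<longleftrightarrow> is_mle y K W Y L c z' \<alpha> \<beta> \<gamma>"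
proof -
  have "log_likelihood y K W Y z a = log_likelihood y K W Y z' a" for a
    unfolding log_likelihood_def by (rule arg_cong[where f = uminus], rule sum.cong) (simp_all add: z)
  then show ?thesis unfolding is_mle_def by presburger
qed

text \<open>Contains no probability: the only information on the responses is the bound
  \<open>g\<close> on the squared norm of the projected score.\<close>

lemma mle_error_bound:
  fixes z :: "nat \<Rightarrow> real" and y :: "real list" and c :: real
  defines "N \<equiv> length y" and "\<omega> \<equiv> 1 / (2 + 2 * exp (2 * c))"
  assumes mle: "is_mle y K W Y L c z \<alpha> \<beta> \<gamma>" and true: "mle_feasible y L c \<alpha>' \<beta>' \<gamma>'"
    and y: "sorted_wrt (<) y" "N \<ge> 2" and K: "K \<ge> 1" and c: "c > 0" and lam: "lam > 0"
    and z: "\<And>k. k < K \<Longrightarrow> z k = 1 \<or> z k = - 1"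
    and v: "\<And>k. k < K \<Longrightarrow> v k = (if z k = 1 then 1 else 0)
      - 1 / (1 + exp (- (\<Sum>j<N. pdiff y W Y k j * \<alpha>' $ j)))"
    and e: "orthonormal K e r"
    and span: "\<And>d. \<exists>a. \<forall>k<K. (\<Sum>j<N - 1. d j * pdiff y W Y k (j + 1)) = (\<Sum>i<r. a i * e i k)"
    and g: "(\<Sum>i<r. (\<Sum>k<K. e i k * v k)\<^sup>2) \<le> g"
  shows "mat_seminorm (transpose_mat (Q_mat N) * (Sigma_D y K W Y + lam \<cdot>\<^sub>m 1\<^sub>m (N - 1)) * Q_mat N)
      (\<alpha> - \<alpha>')
    \<le> sqrt (g / (\<omega>\<^sup>2 * real K)) + sqrt (g / (\<omega>\<^sup>2 * real K) + lam * (c * sqrt (real (N - 1)))\<^sup>2)"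
proof -
  define D where "D k = (\<Sum>j<N. pdiff y W Y k j * (\<alpha> $ j - \<alpha>' $ j))" for k
  define \<omega>' where "\<omega>' = 1 / (2 + 2 * exp c)"
  have feas: "mle_feasible y L c \<alpha> \<beta> \<gamma>"
    using mle by (simp add: is_mle_def is_arg_max_linorder)
  have len: "length y \<ge> 2" using y by (simp add: N_def)
  have car: "\<alpha> \<in> carrier_vec N" "\<alpha>' \<in> carrier_vec N" and zero: "\<alpha> $ 0 = 0" "\<alpha>' $ 0 = 0"
    and \<gamma>: "\<gamma> \<le> c" "\<gamma>' \<le> c"
    using feas true by (auto simp: mle_feasible_def Let_def N_def)
  have x_j: "(\<alpha> - \<alpha>') $ j = \<alpha> $ j - \<alpha>' $ j" if "j < N" for j
    using car that by auto
  have x0: "(\<alpha> - \<alpha>') $ 0 = 0" using x_j[of 0] zero y(2) by simp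
  have xc: "\<alpha> - \<alpha>' \<in> carrier_vec N" using car by simp
  have split: "(\<Sum>i<N. f i) = f 0 + (\<Sum>i<N - 1. f (i + 1))" for f :: "nat \<Rightarrow> real"
    using sum.lessThan_Suc_shift[of f "N - 1"] y(2) by simp
  have D': "D k = (\<Sum>j<N - 1. (\<alpha> $ (j + 1) - \<alpha>' $ (j + 1)) * pdiff y W Y k (j + 1))" for k
    by (simp add: D_def split zero mult.commute)
  obtain a where a: "\<And>k. k < K \<Longrightarrow> D k = (\<Sum>i<r. a i * e i k)"
    unfolding D' using span[of "\<lambda>j. \<alpha> $ (j + 1) - \<alpha>' $ (j + 1)"] by blast
  have g0: "g \<ge> 0" using g by (rule order_trans[rotated]) (simp add: sum_nonneg)
  have S0: "(\<Sum>k<K. (D k)\<^sup>2) \<ge> 0" by (simp add: sum_nonneg)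
  have "\<omega>' / 2 * (\<Sum>k<K. (D k)\<^sup>2) \<le> (\<Sum>k<K. v k * D k)"
    using mle_basic_inequality[OF mle true y(1) len z] v
    by (simp add: \<omega>'_def D_def N_def)
  also have "\<dots> \<le> sqrt (\<Sum>i<r. (\<Sum>k<K. e i k * v k)\<^sup>2) * sqrt (\<Sum>k<K. (D k)\<^sup>2)"
    by (rule sum_mult_le_projection[OF e a])
  also have "\<dots> \<le> sqrt g * sqrt (\<Sum>k<K. (D k)\<^sup>2)"
    using g S0 by (intro mult_right_mono) auto
  finally have "(\<Sum>k<K. (D k)\<^sup>2) \<le> 4 * g / \<omega>'\<^sup>2"
    using g0 S0 by (intro square_le_of_quadratic) (auto simp: \<omega>'_def add_pos_pos)
  \<comment> \<open>The curvature constant \<open>\<omega>'\<close> with \<open>exp c\<close>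
    exceeds \<open>\<omega>\<close> with \<open>exp (2 * c)\<close>, so the estimate is relaxed to
    the stated constant.\<close>
  also have "\<dots> \<le> 4 * g / \<omega>\<^sup>2"
  proof -
    have "\<omega> \<le> \<omega>'" unfolding \<omega>_def \<omega>'_def
      using c by (intro divide_left_mono mult_pos_pos add_pos_pos) auto
    moreover have "\<omega> > 0" by (simp add: \<omega>_def add_pos_pos)
    ultimately show ?thesis
      using g0 by (intro divide_left_mono power_mono mult_pos_pos) auto
  qed
  finally have "(\<Sum>k<K. (D k)\<^sup>2) / real K \<le> 4 * g / \<omega>\<^sup>2 / real K"
    by (rule divide_right_mono) simp
  then have "(\<Sum>k<K. (D k)\<^sup>2) / real K \<le> 4 * (g / (\<omega>\<^sup>2 * real K))"
    by simp
  \<comment> \<open>Both vectors have entries in \<open>[0, c]\<close>, so each of the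
    \<open>N - 1\<close> coordinates of the error is at most \<open>c\<close> in absolute
    value.\<close>
  moreover have "lam * (\<Sum>j=1..<N. ((\<alpha> - \<alpha>') $ j)\<^sup>2) \<le> lam * (c * sqrt (real (N - 1)))\<^sup>2"
  proof (intro mult_left_mono)
    have "((\<alpha> - \<alpha>') $ j)\<^sup>2 \<le> c\<^sup>2" if j: "j < N" for j
    proof -
      have "\<bar>\<alpha> $ j - \<alpha>' $ j\<bar> \<le> \<bar>c\<bar>"
        using mle_feasible_bounds[OF feas y(1) len, of j] mle_feasible_bounds[OF true y(1) len, of j]
          j \<gamma> by (simp add: N_def)
      then show ?thesis using x_j[OF j] by (simp add: abs_le_square_iff)
    qed
    then have "(\<Sum>j=1..<N. ((\<alpha> - \<alpha>') $ j)\<^sup>2) \<le> (\<Sum>j=1..<N. c\<^sup>2)"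
      by (intro sum_mono) auto
    then show "(\<Sum>j=1..<N. ((\<alpha> - \<alpha>') $ j)\<^sup>2) \<le> (c * sqrt (real (N - 1)))\<^sup>2"
      by (simp add: power_mult_distrib mult.commute)
  qed (use lam in simp)
  moreover have "(\<Sum>k<K. (\<Sum>j<N. pdiff y W Y k j * (\<alpha> - \<alpha>') $ j)\<^sup>2) = (\<Sum>k<K. (D k)\<^sup>2)"
    using x_j by (simp add: D_def)
  ultimately have "(\<alpha> - \<alpha>') \<bullet> ((transpose_mat (Q_mat N) * (Sigma_D y K W Y + lam \<cdot>\<^sub>m 1\<^sub>m (N - 1)) * Q_mat N)
      *\<^sub>v (\<alpha> - \<alpha>')) \<le> 4 * (g / (\<omega>\<^sup>2 * real K)) + lam * (c * sqrt (real (N - 1)))\<^sup>2"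
    using quadratic_form_grid[of "\<alpha> - \<alpha>'" y K W Y lam] xc x0 y(2) by (simp add: N_def)
  then show ?thesis
    unfolding mat_seminorm_def using g0 lam by (intro sqrt_le_sqrt_add_sqrt) auto
qed

section \<open>The random responses and the probability estimate\<close>

theorem theorem2:
  fixes M :: "'a measure"
    and b L c \<sigma> \<delta> lam :: real
    and K :: nat
    and W Y :: "nat \<Rightarrow> real pmf"
    and u :: "real \<Rightarrow> real"
    and \<epsilon> :: "nat \<Rightarrow> nat \<Rightarrow> 'a \<Rightarrow> real"
  assumes "prob_space M"
    and "b > 0" "L > 0" "c > 0" "K \<ge> 1"
    and lotteries: "\<And>k. k < K \<Longrightarrow> lottery b (W k)" "\<And>k. k < K \<Longrightarrow> lottery b (Y k)"
    and utility: "u \<in> utility_class b L"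
    and scale: "\<sigma> \<ge> 1 / c"
    and noise_indep:
      "prob_space.indep_vars M (\<lambda>_. borel) (\<lambda>(i, k). \<epsilon> i k) ({1, 2} \<times> {..<K})"
    and noise_gumbel:
      "\<And>i k. i \<in> {1, 2} \<Longrightarrow> k < K \<Longrightarrow> cdf (distr M borel (\<epsilon> i k)) = gumbel_cdf 0 \<sigma>"
    and "lam > 0" "0 < \<delta>" "\<delta> < 1"
  shows
    "let y = grid b K W Y;
         N = length y;
         \<alpha>_true = vec N (\<lambda>j. u (y ! j));
         \<Sigma> = Sigma_D y K W Y;
         R = real (vec_space.rank (N - 1) \<Sigma>);
         \<omega> = 1 / (2 + 2 * exp (2 * c));
         A = transpose_mat (Q_mat N) * (\<Sigma> + lam \<cdot>\<^sub>m 1\<^sub>m (N - 1)) * Q_mat N;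
         Z = (\<lambda>\<xi> k. response u (W k) (Y k) (\<epsilon> 1 k \<xi>) (\<epsilon> 2 k \<xi>));
         C = (R + 2 * sqrt (- R * ln \<delta>) - 2 * ln \<delta>) / (\<omega>\<^sup>2 * real K)
     in measure M {\<xi> \<in> space M. \<forall>\<alpha> \<beta> \<gamma>. is_mle y K W Y L c (Z \<xi>) \<alpha> \<beta> \<gamma> \<longrightarrow>
          mat_seminorm A ((1 / sigma_MLE \<gamma>) \<cdot>\<^sub>v alpha_MLE \<alpha> \<gamma> - (1 / \<sigma>) \<cdot>\<^sub>v \<alpha>_true)
            \<le> sqrt C + sqrt (C + lam * (c * sqrt (real (N - 1)))\<^sup>2)} \<ge> 1 - \<delta>"
proof -
  interpret prob_space M by (rule assms(1))
  define y where "y = grid b K W Y"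
  define N where "N = length y"
  define \<alpha>' where "\<alpha>' = (1 / \<sigma>) \<cdot>\<^sub>v vec N (\<lambda>j. u (y ! j))"
  define R where "R = real (vec_space.rank (N - 1) (Sigma_D y K W Y))"
  define \<omega> where "\<omega> = 1 / (2 + 2 * exp (2 * c))"
  define A where "A = transpose_mat (Q_mat N) * (Sigma_D y K W Y + lam \<cdot>\<^sub>m 1\<^sub>m (N - 1)) * Q_mat N"
  define Z where "Z = (\<lambda>\<xi> k. response u (W k) (Y k) (\<epsilon> 1 k \<xi>) (\<epsilon> 2 k \<xi>))"
  define C where "C = (R + 2 * sqrt (- R * ln \<delta>) - 2 * ln \<delta>) / (\<omega>\<^sup>2 * real K)"
  define E where "E V = measure_pmf.expectation V u" for V
  define q where "q k = (\<Sum>j<N. pdiff y W Y k j * \<alpha>' $ j)" for k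
  \<comment> \<open>The centred indicator of a positive response: two values at distance 1, and mean
    zero by the logistic formula.\<close>
  define v where "v k \<xi> = (if Z \<xi> k = 1 then 1 else 0) - 1 / (1 + exp (- q k))" for k \<xi>
  define Good where "Good \<xi> \<longleftrightarrow> (\<forall>\<alpha> \<beta> \<gamma>. is_mle y K W Y L c (Z \<xi>) \<alpha> \<beta> \<gamma> \<longrightarrow>
      mat_seminorm A ((1 / sigma_MLE \<gamma>) \<cdot>\<^sub>v alpha_MLE \<alpha> \<gamma> - \<alpha>')
        \<le> sqrt C + sqrt (C + lam * (c * sqrt (real (N - 1)))\<^sup>2))" for \<xi>
  have \<sigma>: "\<sigma> > 0" by (rule less_le_trans[OF _ scale]) (simp add: \<open>c > 0\<close>)
  have \<sigma>c: "1 / \<sigma> \<le> c" using scale \<open>c > 0\<close> \<sigma> by (simp add: pos_divide_le_eq mult.commute)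
  note grid = grid_props[of b K W Y, OF \<open>b > 0\<close> lotteries, folded y_def N_def]
  have dist: "distinct y" using grid(2) strict_sorted_iff by blast
  \<comment> \<open>The truth competes with \<open>\<gamma> = 1 / \<sigma>\<close>, which is at most
    \<open>c\<close> by the assumption on the scale.\<close>
  obtain \<beta>' where true: "mle_feasible y L c \<alpha>' \<beta>' (1 / \<sigma>)"
    unfolding \<alpha>'_def N_def
    using utility_mle_feasible[OF utility grid(2,3), of "1 / \<sigma>" c] grid(4-6) \<sigma> \<sigma>c
    by (auto simp: N_def)
  have q: "q k = (E (W k) - E (Y k)) / \<sigma>" if k: "k < K" for k
  proof -
    have "E (W k) = (\<Sum>j<N. pmf (W k) (y ! j) * u (y ! j))"
         "E (Y k) = (\<Sum>j<N. pmf (Y k) (y ! j) * u (y ! j))"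
      using k unfolding E_def N_def by (auto intro!: expectation_lottery[OF dist] simp: grid(1))
    then show ?thesis
      by (simp add: q_def \<alpha>'_def pdiff_def left_diff_distrib sum_subtractf diff_divide_distrib
          sum_divide_distrib)
  qed
  have Z1: "Z \<xi> k = 1 \<longleftrightarrow> \<epsilon> 2 k \<xi> \<le> \<epsilon> 1 k \<xi> + (E (W k) - E (Y k))" for \<xi> k
    by (auto simp: Z_def response_def E_def)
  have Z: "Z \<xi> k = 1 \<or> Z \<xi> k = - 1" for \<xi> k
    by (simp add: Z_def response_def)
  have eps[measurable]: "\<epsilon> i k \<in> borel_measurable M" if "i \<in> {1, 2}" "k < K" for i k
    using noise_indep that by (fastforce simp: indep_vars_def)
  have Z_sets: "{\<xi> \<in> space M. Z \<xi> k = 1} \<in> events" if [simp]: "k < K" for k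
    unfolding Z1 by measurable
  have indep_pair: "indep_var borel (\<epsilon> 1 k) borel (\<epsilon> 2 k)" if k: "k < K" for k
  proof -
    let ?X = "\<lambda>(i, k). \<epsilon> i k"
    have "indep_var (PiM {(1::nat, k)} (\<lambda>_. borel)) (\<lambda>\<xi>. restrict (\<lambda>p. ?X p \<xi>) {(1, k)})
        (PiM {(2, k)} (\<lambda>_. borel)) (\<lambda>\<xi>. restrict (\<lambda>p. ?X p \<xi>) {(2, k)})"
      by (rule indep_var_restrict[OF noise_indep]) (use k in auto)
    from indep_var_compose[OF this, of "\<lambda>g. g (1, k)" borel "\<lambda>g. g (2, k)" borel]
    show ?thesis by (simp add: comp_def)
  qed
  have prob_Z: "prob {\<xi> \<in> space M. Z \<xi> k = 1} = 1 / (1 + exp (- q k))" if k: "k < K" for k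
    unfolding Z1 q[OF k]
    using gumbel_difference_logistic[OF indep_pair[OF k] \<sigma> noise_gumbel noise_gumbel] k by simp
  have indep_v: "indep_vars (\<lambda>_. borel) v {..<K}"
  proof -
    let ?X = "\<lambda>(i, k). \<epsilon> i k"
    \<comment> \<open>Grouping the noise by the pair index gives independent blocks, and
      \<open>v k\<close> is a measurable function of block \<open>k\<close>.\<close>
    have "indep_vars (\<lambda>k. PiM ({1, 2} \<times> {k}) (\<lambda>_. borel))
        (\<lambda>k \<xi>. restrict (\<lambda>p. ?X p \<xi>) ({1, 2} \<times> {k})) {..<K}"
      by (rule indep_vars_restrict[OF noise_indep]) (auto simp: disjoint_family_on_def)
    then have "indep_vars (\<lambda>_. borel) (\<lambda>k \<xi>. (\<lambda>g. (if g (2, k) \<le> g (1, k) + (E (W k) - E (Y k)) then 1 else 0)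
        - 1 / (1 + exp (- q k))) (restrict (\<lambda>p. ?X p \<xi>) ({1, 2} \<times> {k}))) {..<K}"
      by (rule indep_vars_compose2) measurable
    then show ?thesis
      by (simp add: v_def[abs_def] Z1)
  qed
  have v_bd: "v k \<xi> \<in> {- 1 / (1 + exp (- q k))..- 1 / (1 + exp (- q k)) + 1}" for k \<xi>
    by (simp add: v_def)
  have v_mean: "expectation (v k) = 0" if k: "k < K" for k
  proof -
    have "expectation (v k) = (\<integral>\<xi>. indicator {\<xi> \<in> space M. Z \<xi> k = 1} \<xi> - 1 / (1 + exp (- q k)) \<partial>M)"
      by (intro Bochner_Integration.integral_cong) (auto simp: v_def indicator_def)
    also have "\<dots> = prob {\<xi> \<in> space M. Z \<xi> k = 1} - 1 / (1 + exp (- q k))"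
    proof (subst Bochner_Integration.integral_diff)
      show "integrable M (indicat_real {\<xi> \<in> space M. Z \<xi> k = 1})"
        by (rule integrable_real_indicator[OF Z_sets[OF k]]) (simp add: emeasure_eq_measure)
    qed (use Z_sets[OF k] in \<open>simp_all add: prob_space\<close>)
    finally show ?thesis using prob_Z[OF k] by simp
  qed
  obtain r e where r: "r \<le> vec_space.rank (N - 1) (Sigma_D y K W Y)" and e: "orthonormal K e r"
    and span: "\<And>d. \<exists>a. \<forall>k<K. (\<Sum>j<N - 1. d j * pdiff y W Y k (j + 1)) = (\<Sum>i<r. a i * e i k)"
    by (rule orthonormal_family_spanning_columns[of y K W Y, folded N_def]) (rule that)
  define G where "G \<xi> = (\<Sum>i<r. (\<Sum>k<K. e i k * v k \<xi>)\<^sup>2)" for \<xi>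
  have t: "- ln \<delta> > 0" using assms by simp
  \<comment> \<open>The choice \<open>t = - ln \<delta>\<close> makes the tail
    \<open>exp (- t)\<close> equal to \<open>\<delta>\<close>.\<close>
  have bad: "prob {\<xi> \<in> space M. real r + 2 * (- ln \<delta>) < G \<xi>} \<le> \<delta>"
    using projection_tail_bound[OF indep_v v_bd v_mean e, of "- ln \<delta>"] \<open>\<delta> > 0\<close>
    by (simp add: G_def)
  have [measurable]: "v k \<in> borel_measurable M" if "k < K" for k
    using indep_v that by (auto simp: indep_vars_def)
  have G_meas[measurable]: "G \<in> borel_measurable M" unfolding G_def by measurable
  have good: "Good \<xi>" if \<xi>: "G \<xi> \<le> real r + 2 * (- ln \<delta>)" for \<xi>
    unfolding Good_def
  proof (intro allI impI)
    fix \<alpha> \<beta> \<gamma> assume mle: "is_mle y K W Y L c (Z \<xi>) \<alpha> \<beta> \<gamma>"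
    \<comment> \<open>Adding the nonnegative cross term and replacing \<open>r\<close> by
      \<open>R\<close> relaxes the threshold to the stated one.\<close>
    have "0 \<le> sqrt (- R * ln \<delta>)"
      using t by (intro real_sqrt_ge_zero) (simp add: R_def mult_nonneg_nonpos)
    moreover have "real r \<le> R" using r by (simp add: R_def)
    ultimately have Gb: "G \<xi> \<le> R + 2 * sqrt (- R * ln \<delta>) - 2 * ln \<delta>"
      using \<xi> by linarith
    have "mat_seminorm A (\<alpha> - \<alpha>') \<le> sqrt C + sqrt (C + lam * (c * sqrt (real (N - 1)))\<^sup>2)"
      unfolding A_def C_def
      by (rule mle_error_bound[where v = "\<lambda>k. v k \<xi>" and y = y and c = c, folded N_def \<omega>_def,
            OF mle true grid(2,4) \<open>K \<ge> 1\<close> \<open>c > 0\<close> \<open>lam > 0\<close> _ _ e span])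
         (use Z Gb in \<open>simp_all add: v_def q_def G_def\<close>)
    moreover have "(1 / sigma_MLE \<gamma>) \<cdot>\<^sub>v alpha_MLE \<alpha> \<gamma> = \<alpha>"
      using mle grid(2,4) by (intro mle_ratio) (auto simp: is_mle_def is_arg_max_linorder N_def)
    ultimately show "mat_seminorm A ((1 / sigma_MLE \<gamma>) \<cdot>\<^sub>v alpha_MLE \<alpha> \<gamma> - \<alpha>')
        \<le> sqrt C + sqrt (C + lam * (c * sqrt (real (N - 1)))\<^sup>2)" by simp
  qed
  have Good_sets: "{\<xi> \<in> space M. Good \<xi>} \<in> events"
  proof -
    \<comment> \<open>For \<open>k < K\<close> the response vector is recovered from the set of
      positive responses, so \<open>Good\<close> depends on the outcome only through that finite
      pattern.\<close>
    define zS where "zS S k = (if k \<in> S then 1 else - 1 :: real)" for S and k :: nat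
    have mle_eq: "is_mle y K W Y L c (Z \<xi>) \<alpha> \<beta> \<gamma>
        \<longleftrightarrow> is_mle y K W Y L c (zS {k \<in> {..<K}. Z \<xi> k = 1}) \<alpha> \<beta> \<gamma>" for \<xi> \<alpha> \<beta> \<gamma>
      using Z[of \<xi>] by (intro is_mle_cong) (auto simp: zS_def)
    show ?thesis
      unfolding Good_def mle_eq
      by (rule sets_Collect_finite_pattern) (auto intro: Z_sets)
  qed
  have "1 - \<delta> \<le> prob {\<xi> \<in> space M. \<not> real r + 2 * (- ln \<delta>) < G \<xi>}"
    using bad by (subst prob_neg) auto
  also have "\<dots> \<le> prob {\<xi> \<in> space M. Good \<xi>}"
    using good Good_sets by (intro finite_measure_mono) auto
  finally show ?thesis
    unfolding Let_def Good_def A_def C_def \<omega>_def R_def Z_def \<alpha>'_def N_def y_def .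
qed

end
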